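(* Let $\mathfrak g$ be a complex simple Lie algebra of type $A_\ell$ with $\ell$ odd, $D_\ell$ ($\ell\ge4$), $E_6$, $E_7$ or $E_8$, with (even) Coxeter number $h$, $g=h/2$, and with $I_1,I_2$, $(Z\cdot\beta_i)_+$ and $n(\varphi)$ as in the context. Then for any $i\in I_1$ the map $$(Z\cdot\beta_i)_+\to\{0,1,\dots,g-1\},\qquad\varphi\mapsto\frac{n(\varphi)-1}{2}$$ is a bijection, and for any $i\in I_2$ the map $$(Z\cdot\beta_i)_+\to\{1,\dots,g\},\qquad\varphi\mapsto\frac{n(\varphi)}{2}$$ is a bijection.
   Context: Let $\ell$ be the rank of $\mathfrak g$, $I=\{1,\dots,\ell\}$, $\Delta$ the roots of $\mathfrak g$ with respect to a Cartan subalgebra, $\Delta_+$ a choice of positive roots, $\Pi=\{\alpha_i\mid i\in I\}$ the simple roots, $W$ the Weyl group, $\psi$ the highest root, and $h$ the Coxeter number (so $\ell(h+1)=\dim\mathfrak g$). There is a unique partition $\Pi=\Pi_1\cup\Pi_2$, with $\Pi_k=\{\alpha_i\mid i\in I_k\}$ and $I=I_1\sqcup I_2$, such that distinct roots in the same $\Pi_k$ are orthogonal and all roots in $\Pi_2$ are orthogonal to $\psi$ ($\Pi_2$ may be empty, for $A_1$). Let $s_i\in W$ be the reflection in $\alpha_i$, $\tau_k=\prod_{i\in I_k}s_i$ for $k=1,2$, $\sigma=\tau_2\tau_1$ (a Coxeter element), and $Z\subset W$ the cyclic group generated by $\sigma$. Put $\beta_i=\alpha_i$ if $i\in I_1$ and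 $\beta_i=-\alpha_i$ if $i\in I_2$. The set $\Delta_+$ is the disjoint union over $i\in I$ of the sets $(Z\cdot\beta_i)_+=\Delta_+\cap Z\cdot\beta_i$. For $\varphi\in\Delta_+$, $i_\varphi\in I$ is the index with $\varphi\in(Z\cdot\beta_{i_\varphi})_+$, and $k_\varphi\in\{1,2\}$ is the number with $i_\varphi\in I_{k_\varphi}$. Then $n(\varphi)$ denotes the unique integer with $1\le n(\varphi)\le h$, of the same parity as $k_\varphi$, such that $\sigma^{(n(\varphi)-1)/2}(\varphi)=\beta_{i_\varphi}$ if $k_\varphi=1$, and $\sigma^{n(\varphi)/2}(\varphi)=\beta_{i_\varphi}$ if $k_\varphi=2$. *)

theory Defs
  imports Complex_Main "HOL-Algebra.Bij" "HOL-Algebra.Generated_Groups"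
    "HOL-Algebra.Multiplicative_Group"
begin

section \<open>Complex simple Lie algebras\<close>

locale complex_lie_algebra = finite_dimensional_vector_space scale Basis
  for scale :: "complex \<Rightarrow> 'g::ab_group_add \<Rightarrow> 'g" and Basis :: "'g set" +
  fixes br :: "'g \<Rightarrow> 'g \<Rightarrow> 'g"
  assumes br_add_left: "br (x + y) z = br x z + br y z"
    and br_add_right: "br x (y + z) = br x y + br x z"
    and br_scale_left: "br (scale c x) y = scale c (br x y)"
    and br_scale_right: "br x (scale c y) = scale c (br x y)"
    and br_self: "br x x = 0"
    and jacobi: "br x (br y z) + br y (br z x) + br z (br x y) = 0"

definition lie_ideal ::
  "(complex \<Rightarrow> 'g::ab_group_add \<Rightarrow> 'g) \<Rightarrow> ('g \<Rightarrow> 'g \<Rightarrow> 'g) \<Rightarrow> 'g set \<Rightarrow> bool" where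
  "lie_ideal scale br J \<longleftrightarrow> module.subspace scale J \<and> (\<forall>x. \<forall>y\<in>J. br x y \<in> J)"

locale complex_simple_lie_algebra = complex_lie_algebra +
  assumes nonabelian: "\<exists>x y. br x y \<noteq> 0"
    and simple: "lie_ideal scale br J \<Longrightarrow> J = {0} \<or> J = UNIV"

text \<open>
  The definition of a Cartan subalgebra used here is the usual one for semisimple complex Lie
  algebras: an abelian, self-centralizing subalgebra all of whose elements are ad-diagonalizable.
\<close>

definition cartan_subalgebra ::
  "(complex \<Rightarrow> 'g::ab_group_add \<Rightarrow> 'g) \<Rightarrow> ('g \<Rightarrow> 'g \<Rightarrow> 'g) \<Rightarrow> 'g set \<Rightarrow> bool" where
  "cartan_subalgebra scale br H \<longleftrightarrow>
     module.subspace scale H \<and>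
     (\<forall>x\<in>H. \<forall>y\<in>H. br x y = 0) \<and>
     (\<forall>x. (\<forall>y\<in>H. br y x = 0) \<longrightarrow> x \<in> H) \<and>
     (\<forall>y\<in>H. module.span scale {x. \<exists>c. br y x = scale c x} = UNIV)"

definition lin_trace ::
  "(complex \<Rightarrow> 'g::ab_group_add \<Rightarrow> 'g) \<Rightarrow> 'g set \<Rightarrow> ('g \<Rightarrow> 'g) \<Rightarrow> complex" where
  "lin_trace scale Basis f = (\<Sum>b\<in>Basis. module.representation scale Basis (f b) b)"

definition killing_form ::
  "(complex \<Rightarrow> 'g::ab_group_add \<Rightarrow> 'g) \<Rightarrow> 'g set \<Rightarrow> ('g \<Rightarrow> 'g \<Rightarrow> 'g) \<Rightarrow> 'g \<Rightarrow> 'g \<Rightarrow> complex" where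
  "killing_form scale Basis br x y = lin_trace scale Basis (\<lambda>z. br x (br y z))"

text \<open>
  Elements of \<open>H\<^sup>*\<close> are represented by functions on the whole Lie algebra that are linear on \<open>H\<close>
  and vanish outside \<open>H\<close>.
\<close>

definition dual_space ::
  "(complex \<Rightarrow> 'g::ab_group_add \<Rightarrow> 'g) \<Rightarrow> 'g set \<Rightarrow> ('g \<Rightarrow> complex) set" where
  "dual_space scale H =
     {f. (\<forall>x\<in>H. \<forall>y\<in>H. f (x + y) = f x + f y) \<and>
         (\<forall>c. \<forall>x\<in>H. f (scale c x) = c * f x) \<and> (\<forall>x. x \<notin> H \<longrightarrow> f x = 0)}"

definition root_space ::
  "(complex \<Rightarrow> 'g::ab_group_add \<Rightarrow> 'g) \<Rightarrow> ('g \<Rightarrow> 'g \<Rightarrow> 'g) \<Rightarrow> 'g set \<Rightarrow> ('g \<Rightarrow> complex) \<Rightarrow> 'g set" where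
  "root_space scale br H a = {x. \<forall>y\<in>H. br y x = scale (a y) x}"

definition roots ::
  "(complex \<Rightarrow> 'g::ab_group_add \<Rightarrow> 'g) \<Rightarrow> ('g \<Rightarrow> 'g \<Rightarrow> 'g) \<Rightarrow> 'g set \<Rightarrow> ('g \<Rightarrow> complex) set" where
  "roots scale br H =
     {a \<in> dual_space scale H. a \<noteq> (\<lambda>_. 0) \<and> root_space scale br H a \<noteq> {0}}"

text \<open>The bilinear form on \<open>H\<^sup>*\<close> induced by the Killing form.\<close>

definition dual_vector ::
  "(complex \<Rightarrow> 'g::ab_group_add \<Rightarrow> 'g) \<Rightarrow> 'g set \<Rightarrow> ('g \<Rightarrow> 'g \<Rightarrow> 'g) \<Rightarrow> 'g set
    \<Rightarrow> ('g \<Rightarrow> complex) \<Rightarrow> 'g" where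
  "dual_vector scale Basis br H f =
     (THE t. t \<in> H \<and> (\<forall>x\<in>H. killing_form scale Basis br t x = f x))"

definition dual_form ::
  "(complex \<Rightarrow> 'g::ab_group_add \<Rightarrow> 'g) \<Rightarrow> 'g set \<Rightarrow> ('g \<Rightarrow> 'g \<Rightarrow> 'g) \<Rightarrow> 'g set
    \<Rightarrow> ('g \<Rightarrow> complex) \<Rightarrow> ('g \<Rightarrow> complex) \<Rightarrow> complex" where
  "dual_form scale Basis br H f g =
     killing_form scale Basis br (dual_vector scale Basis br H f) (dual_vector scale Basis br H g)"

section \<open>Simple roots and Dynkin type\<close>

definition nonneg_combs :: "(nat \<Rightarrow> 'g \<Rightarrow> complex) \<Rightarrow> nat set \<Rightarrow> ('g \<Rightarrow> complex) set" where
  "nonneg_combs \<alpha> I = {\<phi>. \<exists>c :: nat \<Rightarrow> nat. \<phi> = (\<lambda>x. \<Sum>i\<in>I. of_nat (c i) * \<alpha> i x)}"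

definition positive_roots ::
  "('g \<Rightarrow> complex) set \<Rightarrow> (nat \<Rightarrow> 'g \<Rightarrow> complex) \<Rightarrow> nat set \<Rightarrow> ('g \<Rightarrow> complex) set" where
  "positive_roots \<Delta> \<alpha> I = \<Delta> \<inter> nonneg_combs \<alpha> I"

definition simple_roots ::
  "('g \<Rightarrow> complex) set \<Rightarrow> (nat \<Rightarrow> 'g \<Rightarrow> complex) \<Rightarrow> nat set \<Rightarrow> bool" where
  "simple_roots \<Delta> \<alpha> I \<longleftrightarrow>
     \<alpha> ` I \<subseteq> \<Delta> \<and>
     (\<forall>c :: nat \<Rightarrow> complex. (\<forall>x. (\<Sum>i\<in>I. c i * \<alpha> i x) = 0) \<longrightarrow> (\<forall>i\<in>I. c i = 0)) \<and>
     (\<forall>\<phi>\<in>\<Delta>. \<phi> \<in> nonneg_combs \<alpha> I \<or> (\<lambda>x. - \<phi> x) \<in> nonneg_combs \<alpha> I)"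

definition highest_root ::
  "('g \<Rightarrow> complex) set \<Rightarrow> (nat \<Rightarrow> 'g \<Rightarrow> complex) \<Rightarrow> nat set \<Rightarrow> ('g \<Rightarrow> complex) \<Rightarrow> bool" where
  "highest_root \<Delta> \<alpha> I \<psi> \<longleftrightarrow> \<psi> \<in> \<Delta> \<and> (\<forall>\<phi>\<in>\<Delta>. (\<lambda>x. \<psi> x - \<phi> x) \<in> nonneg_combs \<alpha> I)"

datatype dynkin_series = Type_A | Type_D | Type_E

text \<open>
  Edges of the Dynkin diagrams on the nodes \<open>1, \<dots>, l\<close>, in Bourbaki's numbering; every edge is
  listed in one direction only.
\<close>

fun dynkin_edge :: "dynkin_series \<Rightarrow> nat \<Rightarrow> nat \<Rightarrow> nat \<Rightarrow> bool" where
  "dynkin_edge Type_A l i j \<longleftrightarrow> j = i + 1"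
| "dynkin_edge Type_D l i j \<longleftrightarrow> (j = i + 1 \<and> j < l) \<or> (i + 2 = l \<and> j = l)"
| "dynkin_edge Type_E l i j \<longleftrightarrow> (i = 1 \<and> j = 3) \<or> (i = 2 \<and> j = 4) \<or> (3 \<le> i \<and> j = i + 1)"

definition cartan_entry :: "dynkin_series \<Rightarrow> nat \<Rightarrow> nat \<Rightarrow> nat \<Rightarrow> complex" where
  "cartan_entry X l i j =
     (if i = j then 2 else if dynkin_edge X l i j \<or> dynkin_edge X l j i then - 1 else 0)"

text \<open>
  The Cartan matrix of the simple roots \<open>\<alpha> 1, \<dots>, \<alpha> l\<close> is that of type \<open>X\<^sub>l\<close>, up to renumbering.
\<close>

definition has_dynkin_type ::
  "(('g \<Rightarrow> complex) \<Rightarrow> ('g \<Rightarrow> complex) \<Rightarrow> complex) \<Rightarrow> (nat \<Rightarrow> 'g \<Rightarrow> complex) \<Rightarrow> nat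
    \<Rightarrow> dynkin_series \<Rightarrow> bool" where
  "has_dynkin_type B \<alpha> l X \<longleftrightarrow>
     (\<exists>p. bij_betw p {1..l} {1..l} \<and>
          (\<forall>i\<in>{1..l}. \<forall>j\<in>{1..l}.
             2 * B (\<alpha> i) (\<alpha> j) / B (\<alpha> j) (\<alpha> j) = cartan_entry X l (p i) (p j)))"

section \<open>The bipartite Coxeter element, its orbits, and the function n\<close>

text \<open>
  Throughout, \<open>V\<close> is the space \<open>H\<^sup>*\<close> with its bilinear form \<open>B\<close>, and the Weyl group is viewed inside
  the group \<open>BijGroup V\<close> of bijections of \<open>V\<close>, whose multiplication is composition.
\<close>

definition reflection ::
  "('g \<Rightarrow> complex) set \<Rightarrow> (('g \<Rightarrow> complex) \<Rightarrow> ('g \<Rightarrow> complex) \<Rightarrow> complex) \<Rightarrow> ('g \<Rightarrow> complex)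
    \<Rightarrow> ('g \<Rightarrow> complex) \<Rightarrow> ('g \<Rightarrow> complex)" where
  "reflection V B a = (\<lambda>f\<in>V. (\<lambda>x. f x - 2 * B f a / B a a * a x))"

text \<open>
  The product \<open>\<tau>\<close> of the simple reflections with index in \<open>J\<close>. It is only used when these commute
  (mutually orthogonal simple roots), so taking the factors in increasing order is immaterial.
\<close>

definition reflection_prod ::
  "('g \<Rightarrow> complex) set \<Rightarrow> (('g \<Rightarrow> complex) \<Rightarrow> ('g \<Rightarrow> complex) \<Rightarrow> complex)
    \<Rightarrow> (nat \<Rightarrow> 'g \<Rightarrow> complex) \<Rightarrow> nat set \<Rightarrow> ('g \<Rightarrow> complex) \<Rightarrow> ('g \<Rightarrow> complex)" where
  "reflection_prod V B \<alpha> J =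
     foldr (\<lambda>i w. reflection V B (\<alpha> i) \<otimes>\<^bsub>BijGroup V\<^esub> w) (sorted_list_of_set J) \<one>\<^bsub>BijGroup V\<^esub>"

definition coxeter_element ::
  "('g \<Rightarrow> complex) set \<Rightarrow> (('g \<Rightarrow> complex) \<Rightarrow> ('g \<Rightarrow> complex) \<Rightarrow> complex)
    \<Rightarrow> (nat \<Rightarrow> 'g \<Rightarrow> complex) \<Rightarrow> nat set \<Rightarrow> nat set \<Rightarrow> ('g \<Rightarrow> complex) \<Rightarrow> ('g \<Rightarrow> complex)" where
  "coxeter_element V B \<alpha> I1 I2 =
     reflection_prod V B \<alpha> I2 \<otimes>\<^bsub>BijGroup V\<^esub> reflection_prod V B \<alpha> I1"

text \<open>The Coxeter number is the order of a Coxeter element.\<close>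

definition coxeter_number ::
  "('g \<Rightarrow> complex) set \<Rightarrow> (('g \<Rightarrow> complex) \<Rightarrow> ('g \<Rightarrow> complex)) \<Rightarrow> nat" where
  "coxeter_number V \<sigma> = group.ord (BijGroup V) \<sigma>"

definition signed_simple_root ::
  "(nat \<Rightarrow> 'g \<Rightarrow> complex) \<Rightarrow> nat set \<Rightarrow> nat \<Rightarrow> 'g \<Rightarrow> complex" where
  "signed_simple_root \<alpha> I1 i = (if i \<in> I1 then \<alpha> i else (\<lambda>x. - \<alpha> i x))"

text \<open>The set \<open>(Z \<cdot> b)\<^sub>+\<close>, where \<open>Z\<close> is the cyclic group generated by \<open>\<sigma>\<close> and \<open>P = \<Delta>\<^sub>+\<close>.\<close>

definition orbit_pos ::
  "('g \<Rightarrow> complex) set \<Rightarrow> ('g \<Rightarrow> complex) set \<Rightarrow> (('g \<Rightarrow> complex) \<Rightarrow> ('g \<Rightarrow> complex))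
    \<Rightarrow> ('g \<Rightarrow> complex) \<Rightarrow> ('g \<Rightarrow> complex) set" where
  "orbit_pos V P \<sigma> b = P \<inter> {w b | w. w \<in> generate (BijGroup V) {\<sigma>}}"

definition orbit_index ::
  "('g \<Rightarrow> complex) set \<Rightarrow> ('g \<Rightarrow> complex) set \<Rightarrow> (('g \<Rightarrow> complex) \<Rightarrow> ('g \<Rightarrow> complex))
    \<Rightarrow> (nat \<Rightarrow> 'g \<Rightarrow> complex) \<Rightarrow> nat set \<Rightarrow> nat set \<Rightarrow> ('g \<Rightarrow> complex) \<Rightarrow> nat" where
  "orbit_index V P \<sigma> \<beta> I1 I2 \<phi> = (THE i. i \<in> I1 \<union> I2 \<and> \<phi> \<in> orbit_pos V P \<sigma> (\<beta> i))"

definition orbit_part ::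
  "('g \<Rightarrow> complex) set \<Rightarrow> ('g \<Rightarrow> complex) set \<Rightarrow> (('g \<Rightarrow> complex) \<Rightarrow> ('g \<Rightarrow> complex))
    \<Rightarrow> (nat \<Rightarrow> 'g \<Rightarrow> complex) \<Rightarrow> nat set \<Rightarrow> nat set \<Rightarrow> ('g \<Rightarrow> complex) \<Rightarrow> nat" where
  "orbit_part V P \<sigma> \<beta> I1 I2 \<phi> = (if orbit_index V P \<sigma> \<beta> I1 I2 \<phi> \<in> I1 then 1 else 2)"

text \<open>
  The parity condition makes the divisions by 2 in the exponents exact.
\<close>

definition root_number ::
  "('g \<Rightarrow> complex) set \<Rightarrow> ('g \<Rightarrow> complex) set \<Rightarrow> (('g \<Rightarrow> complex) \<Rightarrow> ('g \<Rightarrow> complex))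
    \<Rightarrow> (nat \<Rightarrow> 'g \<Rightarrow> complex) \<Rightarrow> nat set \<Rightarrow> nat set \<Rightarrow> ('g \<Rightarrow> complex) \<Rightarrow> nat" where
  "root_number V P \<sigma> \<beta> I1 I2 \<phi> =
     (let b = \<beta> (orbit_index V P \<sigma> \<beta> I1 I2 \<phi>); k = orbit_part V P \<sigma> \<beta> I1 I2 \<phi> in
      THE n. 1 \<le> n \<and> n \<le> coxeter_number V \<sigma> \<and> (even n \<longleftrightarrow> even k) \<and>
        (k = 1 \<longrightarrow> (\<sigma> [^]\<^bsub>BijGroup V\<^esub> ((n - 1) div 2)) \<phi> = b) \<and>
        (k = 2 \<longrightarrow> (\<sigma> [^]\<^bsub>BijGroup V\<^esub> (n div 2)) \<phi> = b))"

end

(*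
  Projecting the root lattice to the Coxeter plane, the two factors of the Coxeter element become
  reflections and the Coxeter element becomes a rotation by 2 pi / h. Concretely, a positive eigenvector
  of the Cartan matrix with eigenvalue 2 - 2 cos (pi / h) gives a projection that sends the simple roots
  of each part to positive multiples of one vector, the two vectors being at angle pi - pi / h. Every
  root is a nonnegative or nonpositive combination of simple roots, so its sign can be read off from the
  half plane that contains its projection: along an orbit of length h = 2g, there are g positive roots
  followed by g negative ones. Comparing angles also separates the orbits.

  That g steps of the Coxeter element form an involution needs no longest element: after g steps a root
  +- alpha_i lands on an edge of the cone of negative (positive) roots, where one of the two factors
  acts as -1.
*)

theory Submission
  imports Defs
begin

section \<open>The Killing form and root reflections\<close>

context vector_space
begin

text \<open>Two facts have to be extracted from the Lie algebra: the simple roots form a basis of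
  the dual of \<open>H\<close>, and the set of roots is stable under the simple reflections. The
  second comes from sl2 strings in the adjoint action: for an integral Cartan number k, an explicit
  nonzero vector of the root space of b - k a is produced. After that the argument lives in
  coordinates with respect to the simple roots, where only this stability and the sign dichotomy for
  roots matter. The number g enters through the eigenvalue of an explicit eigenvector for each type;
  that it is h/2 follows later, from the order of the Coxeter element. Orbits are followed with the
  inverse Coxeter element, because n counts powers of \<sigma> that bring a root back to its \<beta>
  i: m inverse steps from \<beta> i give n = 2m + 1 or n = 2m. Signs are read after a rotation by
  half of \<theta> = \<pi>/(2g), which centres the cone of positive roots in the upper half plane.
  Orbit directions then become odd multiples of \<theta>/2 and \<pi> is an even one, so no orbit
  root lies on the dividing line.\<close>

lemma eigenvector_sum_zero:
  assumes lin: "Vector_Spaces.linear scale scale f" and "finite C"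
    and "\<And>c. c \<in> C \<Longrightarrow> f (u c) = scale c (u c)" and "(\<Sum>c\<in>C. u c) = 0" and "c \<in> C"
  shows "u c = 0"
proof -
  interpret f: Vector_Spaces.linear scale scale f by (rule lin)
  show ?thesis
    using assms(2-5)
  proof (induction C arbitrary: u c rule: finite_induct)
    case empty
    then show ?case by simp
  next
    case (insert d C)
    have d: "u d = - (\<Sum>c\<in>C. u c)"
      using insert.prems(2) insert.hyps by (simp add: eq_neg_iff_add_eq_0)
    \<comment> \<open>Subtracting \<open>d\<close> times the identity from \<open>f\<close> kills
      the summand at \<open>d\<close> and multiplies the others by the nonzero factors
      \<open>c - d\<close>.\<close>
    have "0 = f (\<Sum>c\<in>insert d C. u c) - scale d (\<Sum>c\<in>insert d C. u c)"
      using insert.prems(2) by (simp only: f.zero scale_zero_right diff_self)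
    also have "\<dots> = (\<Sum>c\<in>insert d C. scale (c - d) (u c))"
      using insert.prems(1)
      by (simp only: f.sum scale_sum_right sum_subtractf[symmetric])
        (auto intro!: sum.cong simp: scale_left_diff_distrib)
    also have "\<dots> = (\<Sum>c\<in>C. scale (c - d) (u c))"
      using insert.hyps by simp
    finally have sum0: "(\<Sum>c\<in>C. scale (c - d) (u c)) = 0" by simp
    have eig: "f (scale (c - d) (u c)) = scale c (scale (c - d) (u c))" if "c \<in> C" for c
      using insert.prems(1)[of c] that by (simp add: f.scale mult.commute)
    have C0: "u c = 0" if "c \<in> C" for c
      using insert.IH[where u = "\<lambda>c. scale (c - d) (u c)", OF eig sum0 that] insert.hyps that by auto
    then have "u d = 0" using d by simp
    then show ?case using C0 insert.prems(3) by auto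
  qed
qed

text \<open>Components are indexed by their eigenvalue, so that contributions to one eigenvalue are
  merged and \<open>eigenvector_sum_zero\<close> can compare components.\<close>

lemma diagonalizable_decomposition:
  assumes lin: "Vector_Spaces.linear scale scale f"
    and diag: "span {x. \<exists>c. f x = scale c x} = UNIV"
  obtains C u where "finite C" "\<And>c. f (u c) = scale c (u c)" "x = (\<Sum>c\<in>C. u c)"
proof -
  interpret f: Vector_Spaces.linear scale scale f by (rule lin)
  have span_x: "x \<in> span {x. \<exists>c. f x = scale c x}" by (simp add: diag)
  have "\<exists>C u. finite C \<and> (\<forall>c. f (u c) = scale c (u c)) \<and> (\<forall>c. c \<notin> C \<longrightarrow> u c = 0) \<and>
      x = (\<Sum>c\<in>C. u c)"
    using span_x
  proof (induction x rule: span_induct_alt)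
    case base
    then show ?case by (intro exI[of _ "{}"] exI[of _ "\<lambda>_. 0"]) simp
  next
    case (step k x y)
    then obtain d where d: "f x = scale d x" by auto
    from step obtain C u where u: "finite C" "\<forall>c. f (u c) = scale c (u c)"
      "\<forall>c. c \<notin> C \<longrightarrow> u c = 0" "y = (\<Sum>c\<in>C. u c)" by auto
    let ?u = "\<lambda>c. (if c = d then scale k x else 0) + u c"
    have "(\<Sum>c\<in>insert d C. u c) = (\<Sum>c\<in>C. u c)"
      using u by (intro sum.mono_neutral_right) auto
    then have "scale k x + y = (\<Sum>c\<in>insert d C. ?u c)"
      using u by (simp add: sum.distrib)
    moreover have "f (?u c) = scale c (?u c)" for c
      using u d by (simp add: f.add f.scale scale_right_distrib mult.commute)
    moreover have "?u c = 0" if "c \<notin> insert d C" for c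
      using u that by simp
    ultimately show ?case
      using u by (intro exI[of _ "insert d C"] exI[of _ ?u]) simp
  qed
  then show ?thesis using that by blast
qed

text \<open>Commuting maps preserve each other's eigenspaces. Hence the \<open>f\<close>-components
  of a joint eigenvector for \<open>S\<close> are again joint eigenvectors for \<open>S\<close>, and
  in addition eigenvectors of \<open>f\<close>.\<close>

lemma simultaneously_diagonalizable:
  assumes "finite S"
    and "\<And>f. f \<in> S \<Longrightarrow> Vector_Spaces.linear scale scale f"
    and "\<And>f. f \<in> S \<Longrightarrow> span {x. \<exists>c. f x = scale c x} = UNIV"
    and "\<And>f g x. f \<in> S \<Longrightarrow> g \<in> S \<Longrightarrow> f (g x) = g (f x)"
  shows "span {x. \<forall>f\<in>S. \<exists>c. f x = scale c x} = UNIV"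
  using assms
proof (induction S rule: finite_induct)
  case empty
  then show ?case by simp
next
  case (insert f S)
  interpret f: Vector_Spaces.linear scale scale f using insert.prems by simp
  let ?E = "{x. \<forall>f\<in>insert f S. \<exists>c. f x = scale c x}"
  have "x \<in> span ?E" if x: "\<forall>f\<in>S. \<exists>c. f x = scale c x" for x
  proof -
    obtain C u where u: "finite C" "\<And>c. f (u c) = scale c (u c)" "x = (\<Sum>c\<in>C. u c)"
      using diagonalizable_decomposition[OF f.linear_axioms insert.prems(2)] by blast
    have "u c \<in> ?E" if "c \<in> C" for c
    proof -
      have "\<exists>c'. k (u c) = scale c' (u c)" if k: "k \<in> S" for k
      proof -
        interpret k: Vector_Spaces.linear scale scale k using insert.prems k by simp
        obtain d where d: "k x = scale d x" using x k by auto
        have "(\<Sum>c\<in>C. k (u c) - scale d (u c)) = 0"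
          using d u by (simp add: k.sum sum_subtractf scale_sum_right)
        moreover have "f (k (u c) - scale d (u c)) = scale c (k (u c) - scale d (u c))" for c
        proof -
          have "f (k (u c)) = k (f (u c))" using insert.prems(3)[of f k] k by simp
          then show ?thesis
            using u by (simp add: f.diff f.scale k.scale scale_right_diff_distrib mult.commute)
        qed
        ultimately have "k (u c) - scale d (u c) = 0"
          using eigenvector_sum_zero[OF f.linear_axioms u(1), of "\<lambda>c. k (u c) - scale d (u c)"]
            \<open>c \<in> C\<close> by blast
        then show ?thesis by auto
      qed
      then show ?thesis using u by auto
    qed
    then show ?thesis unfolding u(3) by (intro span_sum span_base)
  qed
  then have "span {x. \<forall>f\<in>S. \<exists>c. f x = scale c x} \<subseteq> span ?E"
    by (intro span_minimal) auto
  then show ?case using insert by auto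
qed

end

text \<open>Nonzero vectors with distinct eigenvalues are independent, and infinitely many do not
  fit into finite dimension. This stops the raising operator of an sl2 triple.\<close>

lemma (in finite_dimensional_vector_space) eigenvector_sequence_vanishes:
  assumes lin: "Vector_Spaces.linear scale scale f"
    and eig: "\<And>k :: nat. f (u k) = scale (a k) (u k)" and "inj a"
  shows "\<exists>k. u k = 0"
proof (rule ccontr)
  assume "\<nexists>k. u k = 0"
  then have nz: "u k \<noteq> 0" for k by auto
  have inj: "inj u"
  proof (rule injI)
    fix j k assume "u j = u k"
    then have "scale (a j) (u j) = scale (a k) (u j)" using eig[of j] eig[of k] by metis
    then have "a j = a k" using nz[of j] by simp
    then show "j = k" using \<open>inj a\<close> by (simp add: inj_eq)
  qed
  have "independent (range u)"
  proof (rule notI)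
    assume "dependent (range u)"
    then obtain t w k where t: "finite t" "t \<subseteq> range u" "(\<Sum>x\<in>t. scale (w x) x) = 0"
      "u k \<in> t" "w (u k) \<noteq> 0"
      unfolding dependent_explicit by (metis rangeE subsetD)
    define J where "J = u -` t"
    have J: "finite J" "t = u ` J"
      using t(1,2) inj unfolding J_def by (simp_all add: finite_vimageI image_vimage_eq Int_absorb2)
    have injJ: "inj_on u J" "inj_on a J"
      using inj \<open>inj a\<close> by (auto intro: inj_on_subset)
    \<comment> \<open>The vectors occurring in the dependence, reindexed by eigenvalue through the
      inverse of \<open>a\<close>.\<close>
    define y where "y = (\<lambda>c. scale (w (u (inv_into UNIV a c))) (u (inv_into UNIV a c)))"
    have y: "y (a j) = scale (w (u j)) (u j)" for j
      using \<open>inj a\<close> by (simp add: y_def)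
    interpret f: Vector_Spaces.linear scale scale f by (rule lin)
    have "y (a k) = 0"
    proof (rule eigenvector_sum_zero[OF lin, where C = "a ` J" and u = y])
      show "(\<Sum>c\<in>a ` J. y c) = 0"
        using t(3) unfolding J(2) by (simp add: sum.reindex injJ y)
      show "f (y c) = scale c (y c)" if "c \<in> a ` J" for c
        using that eig by (auto simp: y f.scale mult.commute)
      show "a k \<in> a ` J" using t(4) by (simp add: J_def)
    qed (use J in simp)
    then show False using nz t(5) by (simp add: y)
  qed
  then have "finite (range u)" by (rule finiteI_independent)
  then show False using inj by (simp add: finite_image_iff)
qed

section \<open>Invariance of the Killing form and sl2 strings\<close>

context complex_lie_algebra
begin

sublocale br: Vector_Spaces.linear scale scale "br x" for x
  by unfold_locales (auto simp: br_add_right br_scale_right scale_right_distrib scale_left_distrib)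

lemma br_commute: "br x y = - br y x"
proof -
  have "br (x + y) (x + y) = 0" by (rule br_self)
  then have "br x y + br y x = 0"
    unfolding br_add_left br.add br_self[of x] br_self[of y] by (simp add: add.commute)
  then show ?thesis by (simp add: eq_neg_iff_add_eq_0)
qed

lemma br_minus_left: "br (- x) y = - br x y"
  by (metis br_commute br.neg)

lemma br_zero_left [simp]: "br 0 x = 0"
  using br_scale_left[of 0 0 x] by simp

lemma br_br: "br (br x y) z = br x (br y z) - br y (br x z)"
proof -
  have "br z (br x y) = - br (br x y) z" "br y (br z x) = - br y (br x z)"
    using br_commute[of z "br x y"] br_commute[of z x] by (simp_all add: br.neg)
  then show ?thesis using jacobi[of x y z] by (simp add: algebra_simps)
qed

abbreviation killing ("\<kappa>") where "\<kappa> \<equiv> killing_form scale Basis br"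

lemma lin_trace_comp:
  assumes "Vector_Spaces.linear scale scale f" "Vector_Spaces.linear scale scale g"
  shows "lin_trace scale Basis (\<lambda>x. f (g x)) =
    (\<Sum>b\<in>Basis. \<Sum>c\<in>Basis. representation Basis (g b) c * representation Basis (f c) b)"
  unfolding lin_trace_def
proof (rule sum.cong[OF refl])
  interpret f: Vector_Spaces.linear scale scale f by fact
  fix b assume "b \<in> Basis"
  have "g b = (\<Sum>c\<in>Basis. scale (representation Basis (g b) c) c)"
    using sum_representation_eq[OF independent_Basis _ finite_Basis order_refl, of "g b"] span_Basis
    by simp
  then have "f (g b) = (\<Sum>c\<in>Basis. scale (representation Basis (g b) c) (f c))"
    using f.sum f.scale by (metis (no_types, lifting) sum.cong)
  then show "representation Basis (f (g b)) b =
      (\<Sum>c\<in>Basis. representation Basis (g b) c * representation Basis (f c) b)"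
    by (simp add: representation_sum[OF independent_Basis] representation_scale[OF independent_Basis]
        span_Basis)
qed

lemma lin_trace_commute:
  assumes "Vector_Spaces.linear scale scale f" "Vector_Spaces.linear scale scale g"
  shows "lin_trace scale Basis (\<lambda>x. f (g x)) = lin_trace scale Basis (\<lambda>x. g (f x))"
  unfolding lin_trace_comp[OF assms] lin_trace_comp[OF assms(2,1)]
  by (subst sum.swap) (simp add: mult.commute)

lemma lin_trace_add:
  "lin_trace scale Basis (\<lambda>x. f x + g x) = lin_trace scale Basis f + lin_trace scale Basis g"
  by (simp add: lin_trace_def representation_add[OF independent_Basis] span_Basis sum.distrib)

lemma lin_trace_scale:
  "lin_trace scale Basis (\<lambda>x. scale c (f x)) = c * lin_trace scale Basis f"
  by (simp add: lin_trace_def representation_scale[OF independent_Basis] span_Basis sum_distrib_left)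

lemma lin_trace_diff:
  "lin_trace scale Basis (\<lambda>x. f x - g x) = lin_trace scale Basis f - lin_trace scale Basis g"
  using lin_trace_add[of f "\<lambda>x. scale (-1) (g x)"] lin_trace_scale[of "-1" g] by simp

lemma killing_commute: "\<kappa> x y = \<kappa> y x"
  unfolding killing_form_def by (intro lin_trace_commute br.linear_axioms)

lemma killing_add_right: "\<kappa> x (y + z) = \<kappa> x y + \<kappa> x z"
  by (simp add: killing_form_def br_add_left br.add lin_trace_add)

lemma killing_scale_right: "\<kappa> x (scale c y) = c * \<kappa> x y"
  by (simp add: killing_form_def br_scale_left br.scale lin_trace_scale)

lemma killing_add_left: "\<kappa> (x + y) z = \<kappa> x z + \<kappa> y z"
  using killing_add_right[of z x y] by (simp add: killing_commute)

lemma killing_scale_left: "\<kappa> (scale c x) y = c * \<kappa> x y"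
  using killing_scale_right[of y c x] by (simp add: killing_commute)

lemma killing_diff_left: "\<kappa> (x - y) z = \<kappa> x z - \<kappa> y z"
  using killing_add_left[of x "scale (-1) y" z] by (simp add: killing_scale_left del: scale_minus_left) simp

lemma killing_zero_right [simp]: "\<kappa> x 0 = 0"
  using killing_scale_right[of x 0 0] by simp

lemma killing_zero_left [simp]: "\<kappa> 0 x = 0"
  using killing_scale_left[of 0 0 x] by simp

lemma killing_sum_left: "\<kappa> (sum u A) y = (\<Sum>a\<in>A. \<kappa> (u a) y)"
  by (induction A rule: infinite_finite_induct) (auto simp: killing_add_left)

text \<open>Expanding the adjoint action of a bracket gives tr(xyz) - tr(yxz) on the left and
  tr(xyz) - tr(xzy) on the right; the subtracted traces agree by cyclicity.\<close>

lemma killing_br_left: "\<kappa> (br x y) z = \<kappa> x (br y z)"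
proof -
  have "\<kappa> (br x y) z = lin_trace scale Basis (\<lambda>w. br x (br y (br z w)))
      - lin_trace scale Basis (\<lambda>w. br y (br x (br z w)))"
    by (simp add: killing_form_def br_br lin_trace_diff)
  also have "lin_trace scale Basis (\<lambda>w. br y (br x (br z w)))
      = lin_trace scale Basis (\<lambda>w. br x (br z (br y w)))"
    by (rule lin_trace_commute[where f = "br y" and g = "\<lambda>w. br x (br z w)"])
      (rule br.linear_axioms, rule Vector_Spaces.linear_compose[OF br.linear_axioms br.linear_axioms, unfolded o_def])
  finally show ?thesis
    by (simp add: killing_form_def br_br br.diff lin_trace_diff)
qed

text \<open>The vector exhibited has weight -m, the reflection of the weight m of \<open>x\<close>.
  Raising \<open>x\<close> as long as possible reaches, after q steps, a highest weight vector of
  weight m + 2q; lowering that one m + q times stays within its string.\<close>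

lemma sl2_string_nonzero:
  assumes ef: "br e f = h" and he: "br h e = scale 2 e" and hf: "br h f = scale (- 2) f"
    and hx: "br h x = scale (of_nat m) x" and "x \<noteq> 0"
  shows "\<exists>q. (br f ^^ (m + q)) ((br e ^^ q) x) \<noteq> 0"
proof -
  have hE: "br h ((br e ^^ q) x) = scale (of_nat m + 2 * of_nat q) ((br e ^^ q) x)" for q
  proof (induction q)
    case (Suc q)
    have "br h (br e z) = br (br h e) z + br e (br h z)" for z
      by (simp add: br_br)
    then show ?case
      using Suc by (simp add: he br_scale_left br.scale flip: scale_left_distrib)
  qed (use hx in simp)
  have "\<exists>q. (br e ^^ q) x = 0"
    by (rule eigenvector_sequence_vanishes[OF br.linear_axioms hE]) (auto simp: inj_def)
  then have "(br e ^^ (LEAST q. (br e ^^ q) x = 0)) x = 0" (is "(br e ^^ ?q) x = 0")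
    by (rule LeastI_ex)
  with \<open>x \<noteq> 0\<close> obtain q where q: "?q = Suc q" by (cases ?q) auto
  define y where "y = (br e ^^ q) x"
  have "y \<noteq> 0" using not_less_Least[of q "\<lambda>q. (br e ^^ q) x = 0"] q by (auto simp: y_def)
  have ey: "br e y = 0" using \<open>(br e ^^ ?q) x = 0\<close> q by (simp add: y_def)
  define a where "a = m + 2 * q"
  have hy: "br h y = scale (of_nat a) y" using hE[of q] by (simp add: y_def a_def)
  have hF: "br h ((br f ^^ j) y) = scale (of_nat a - 2 * of_nat j) ((br f ^^ j) y)" for j
  proof (induction j)
    case (Suc j)
    have "br h (br f z) = br (br h f) z + br f (br h z)" for z
      by (simp add: br_br)
    then show ?case
      using Suc by (simp add: hf br_scale_left br.scale flip: scale_left_distrib del: scale_minus_left)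
  qed (use hy in simp)
  \<comment> \<open>The sl2 commutation formula below a highest weight vector. Its scalar is nonzero
    while j < a, so the lowering operator cannot give 0 within the first \<open>a\<close>
    steps.\<close>
  have eF: "br e ((br f ^^ Suc j) y) = scale (of_nat (Suc j) * (of_nat a - of_nat j)) ((br f ^^ j) y)" for j
  proof (induction j)
    case 0
    have "br e (br f y) = br h y + br f (br e y)" by (simp add: br_br flip: ef)
    then show ?case using hy ey by simp
  next
    case (Suc j)
    have "br e (br f z) = br h z + br f (br e z)" for z by (simp add: br_br flip: ef)
    from this[of "(br f ^^ Suc j) y"] show ?case
      using Suc hF[of "Suc j"] by (simp add: br.scale flip: scale_left_distrib) (simp add: algebra_simps)
  qed
  have "(br f ^^ j) y \<noteq> 0" if "j \<le> a" for j
    using that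
  proof (induction j)
    case (Suc j)
    have "of_nat (Suc j) * (of_nat a - of_nat j) \<noteq> (0 :: complex)"
      using Suc.prems by (metis Suc_le_lessD diff_gt_0_iff_gt less_irrefl mult_eq_0_iff of_nat_Suc
          of_nat_eq_iff of_nat_neq_0 right_minus_eq)
    then have "br e ((br f ^^ Suc j) y) \<noteq> 0"
      using Suc eF[of j] by (auto simp del: funpow.simps)
    then show ?case by auto
  qed (use \<open>y \<noteq> 0\<close> in simp)
  from this[of "m + q"] show ?thesis by (auto simp: a_def y_def)
qed

end

section \<open>Weights of a Cartan subalgebra and reflections of roots\<close>

locale cartan_decomposition = complex_simple_lie_algebra scale Basis br
  for scale :: "complex \<Rightarrow> 'g::ab_group_add \<Rightarrow> 'g" and Basis :: "'g set" and br +
  fixes H :: "'g set"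
  assumes cartan: "cartan_subalgebra scale br H"
    and killing_nonzero: "\<exists>x y. \<kappa> x y \<noteq> 0"
begin

abbreviation V where "V \<equiv> dual_space scale H"
abbreviation B where "B \<equiv> dual_form scale Basis br H"
abbreviation \<Delta> where "\<Delta> \<equiv> roots scale br H"

lemma subspace_H: "subspace H"
  and H_abelian: "x \<in> H \<Longrightarrow> y \<in> H \<Longrightarrow> br x y = 0"
  and H_self_centralizing: "(\<And>y. y \<in> H \<Longrightarrow> br y x = 0) \<Longrightarrow> x \<in> H"
  and H_diagonalizable: "y \<in> H \<Longrightarrow> span {x. \<exists>c. br y x = scale c x} = UNIV"
  using cartan unfolding cartan_subalgebra_def by blast+

text \<open>A Killing form that is not identically zero has a proper radical, so Cartan's criterion is not
  needed here.\<close>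

lemma killing_nondegenerate:
  assumes "\<And>y. \<kappa> x y = 0"
  shows "x = 0"
proof -
  let ?J = "{x. \<forall>y. \<kappa> x y = 0}"
  have "lie_ideal scale br ?J"
    unfolding lie_ideal_def
  proof safe
    show "subspace ?J"
      by (auto simp: subspace_def killing_add_left killing_scale_left)
    fix x y z assume "\<forall>z. \<kappa> y z = 0"
    then show "\<kappa> (br x y) z = 0"
      using killing_br_left[of z x y] killing_commute[of "br x y" z] killing_commute[of "br z x" y]
      by simp
  qed
  moreover have "?J \<noteq> UNIV" using killing_nonzero by auto
  ultimately have "?J = {0}" using simple by blast
  then show ?thesis using assms by blast
qed

text \<open>Simultaneous diagonalization handles finitely many maps, so it is applied to a basis of
  \<open>H\<close>; joint eigenvectors for the basis are eigenvectors for all of \<open>H\<close> by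
  linearity.\<close>

lemma span_weight_vectors: "span {x. \<forall>y\<in>H. \<exists>c. br y x = scale c x} = UNIV"
proof -
  obtain D where D: "D \<subseteq> H" "independent D" "H \<subseteq> span D"
    "card D = dim H" by (rule basis_exists)
  have "finite D" using D(2) by (rule finiteI_independent)
  have "span {x. \<forall>f\<in>br ` D. \<exists>c. f x = scale c x} = UNIV"
  proof (rule simultaneously_diagonalizable)
    show "finite (br ` D)" using \<open>finite D\<close> by simp
    show "Vector_Spaces.linear scale scale f" if fD: "f \<in> br ` D" for f
    proof -
      obtain d where "f = br d" using fD by auto
      then show ?thesis using br.linear_axioms[of d] by simp
    qed
    show "span {x. \<exists>c. f x = scale c x} = UNIV" if fD: "f \<in> br ` D" for f
    proof -
      obtain d where "f = br d" "d \<in> H" using fD D(1) by auto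
      then show ?thesis using H_diagonalizable[of d] by simp
    qed
    show "f (g x) = g (f x)" if fg: "f \<in> br ` D" "g \<in> br ` D" for f g x
    proof -
      obtain y z where yz: "f = br y" "g = br z" "y \<in> H" "z \<in> H" using fg D(1) by auto
      show ?thesis using br_br[of y z x] H_abelian[OF yz(3,4)] by (simp add: yz(1,2) br_zero_left)
    qed
  qed
  moreover have "\<forall>y\<in>H. \<exists>c. br y x = scale c x" if x: "\<forall>f\<in>br ` D. \<exists>c. f x = scale c x" for x
  proof
    fix y assume "y \<in> H"
    then have "y \<in> span D" using D(3) by auto
    then show "\<exists>c. br y x = scale c x"
    proof (induction y rule: span_induct_alt)
      case base
      then show ?case by (intro exI[of _ 0]) (simp add: br_zero_left)
    next
      case (step k y z)
      obtain c where "br y x = scale c x" using x step(1) by blast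
      moreover obtain d where "br z x = scale d x" using step(2) by blast
      ultimately have "br (scale k y + z) x = scale (k * c + d) x"
        by (simp add: br_add_left br_scale_left scale_left_distrib)
      then show ?case by blast
    qed
  qed
  then have "span {x. \<forall>f\<in>br ` D. \<exists>c. f x = scale c x} \<subseteq> span {x. \<forall>y\<in>H. \<exists>c. br y x = scale c x}"
    by (intro span_mono) blast
  ultimately show ?thesis by blast
qed

lemma killing_eqI:
  assumes "\<And>z. (\<forall>y\<in>H. \<exists>c. br y z = scale c z) \<Longrightarrow> \<kappa> x z = 0"
  shows "x = 0"
proof (rule killing_nondegenerate)
  fix y
  have "y \<in> span {x. \<forall>y\<in>H. \<exists>c. br y x = scale c x}" by (simp add: span_weight_vectors)
  then show "\<kappa> x y = 0"
    by (induction y rule: span_induct_alt) (auto simp: killing_add_right killing_scale_right assms)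
qed

text \<open>\<open>H\<close> is orthogonal to every weight vector outside \<open>H\<close>: such a
  vector has weight c \<noteq> 0 at some y in \<open>H\<close>, and invariance together with [x, y]
  = 0 gives c \<kappa>(x, z) = 0.\<close>

lemma killing_nondegenerate_on_H:
  assumes "x \<in> H" "\<And>y. y \<in> H \<Longrightarrow> \<kappa> x y = 0"
  shows "x = 0"
proof (rule killing_eqI)
  fix z assume z: "\<forall>y\<in>H. \<exists>c. br y z = scale c z"
  show "\<kappa> x z = 0"
  proof (cases "z \<in> H")
    case False
    then obtain y where y: "y \<in> H" "br y z \<noteq> 0" using H_self_centralizing by blast
    obtain c where c: "br y z = scale c z" using z y by blast
    have "c * \<kappa> x z = \<kappa> (br x y) z" by (simp add: killing_br_left c killing_scale_right)
    then show ?thesis using H_abelian[OF assms(1) y(1)] y c by auto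
  qed (use assms in simp)
qed

text \<open>Surjectivity of t \<mapsto> \<kappa>(t, -) by a dimension count. To count inside
  \<open>H\<close>, a functional is recorded as the vector of \<open>H\<close> whose coordinates in
  the basis \<open>D\<close> are its values on \<open>D\<close>; \<open>T\<close> is the resulting
  endomorphism.\<close>

lemma killing_represents:
  assumes f: "f \<in> V"
  shows "\<exists>!t. t \<in> H \<and> (\<forall>x\<in>H. \<kappa> t x = f x)"
proof -
  obtain D where D: "D \<subseteq> H" "independent D" "H \<subseteq> span D"
    "card D = dim H" by (rule basis_exists)
  have fin: "finite D" using D(2) by (rule finiteI_independent)
  have spanH: "span D = H" using D subspace_H by (simp add: span_minimal subset_antisym)
  define T where "T x = (\<Sum>d\<in>D. scale (\<kappa> x d) d)" for x
  have lin: "Vector_Spaces.linear scale scale T"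
    by unfold_locales
      (auto simp: T_def killing_add_left killing_scale_left scale_left_distrib sum.distrib
        scale_sum_right scale_right_distrib)
  interpret T: Vector_Spaces.linear scale scale T by (rule lin)
  have TH: "T x \<in> H" for x
    unfolding T_def spanH[symmetric] by (intro span_sum span_scale span_base)
  have onD: "x = 0" if "x \<in> H" "\<forall>d\<in>D. \<kappa> x d = 0" for x
  proof (rule killing_nondegenerate_on_H[OF that(1)])
    fix y assume "y \<in> H"
    then have "y \<in> span D" by (simp add: spanH)
    then show "\<kappa> x y = 0"
      by (induction y rule: span_induct_alt)
        (auto simp: killing_add_right killing_scale_right that(2))
  qed
  have coords: "a d = b d" if "(\<Sum>d\<in>D. scale (a d) d) = (\<Sum>d\<in>D. scale (b d) d)" "d \<in> D" for a b d
  proof -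
    have "(\<Sum>d\<in>D. scale (a d - b d) d) = 0"
      using that(1) by (simp add: scale_left_diff_distrib sum_subtractf)
    then show ?thesis
      using independentD[OF D(2) fin order_refl, of "\<lambda>d. a d - b d" d] that(2) by simp
  qed
  have inj: "inj_on T (span H)"
  proof (rule inj_onI)
    fix x y assume xy: "x \<in> span H" "y \<in> span H" "T x = T y"
    have "x - y \<in> H" using xy subspace_H by (metis span_eq_iff subspace_diff)
    moreover have "\<kappa> (x - y) d = 0" if "d \<in> D" for d
      using coords[OF xy(3)[unfolded T_def] that] by (simp add: killing_diff_left)
    ultimately show "x = y" using onD by (metis right_minus_eq)
  qed
  interpret TT: finite_dimensional_vector_space_pair scale Basis scale Basis ..
  have "dim (T ` H) = dim H" using TT.dim_image_eq[OF lin inj] .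
  moreover have "subspace (T ` H)" using T.subspace_image[OF subspace_H] .
  ultimately have img: "T ` H = H"
    using TH subspace_H by (intro subspace_dim_equal) auto
  have "(\<Sum>d\<in>D. scale (f d) d) \<in> H"
    unfolding spanH[symmetric] by (intro span_sum span_scale span_base)
  then obtain t where t: "t \<in> H" "T t = (\<Sum>d\<in>D. scale (f d) d)" using img by (metis imageE)
  have fH: "f (x + y) = f x + f y" "f (scale c x) = c * f x" if "x \<in> H" "y \<in> H" for x y c
    using f that by (auto simp: dual_space_def)
  have tx: "\<kappa> t x = f x" if "x \<in> H" for x
  proof -
    have "x \<in> span D" using that by (simp add: spanH)
    then have "x \<in> H \<and> \<kappa> t x = f x"
    proof (induction x rule: span_induct_alt)
      case base
      have "0 \<in> H" using subspace_H by (rule subspace_0)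
      then show ?case using fH(2)[of 0 0 0] by simp
    next
      case (step c x y)
      have "x \<in> H" using step(1) D(1) by auto
      then have "scale c x \<in> H" using subspace_H by (simp add: subspace_scale)
      moreover have "\<kappa> t x = f x" using coords[OF t(2)[unfolded T_def] step(1)] .
      ultimately show ?case
        using step(2) fH \<open>x \<in> H\<close> subspace_H
        by (simp add: killing_add_right killing_scale_right subspace_add)
    qed
    then show ?thesis by simp
  qed
  show ?thesis
  proof (rule ex1I[of _ t])
    fix s assume s: "s \<in> H \<and> (\<forall>x\<in>H. \<kappa> s x = f x)"
    have "s - t = 0"
      using s t(1) tx subspace_H
      by (intro killing_nondegenerate_on_H) (auto simp: subspace_diff killing_diff_left)
    then show "s = t" by simp
  qed (use t tx in blast)
qed

abbreviation dv where "dv \<equiv> dual_vector scale Basis br H"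

lemma dual_vector_in_H: "f \<in> V \<Longrightarrow> dv f \<in> H"
  and killing_dual_vector: "f \<in> V \<Longrightarrow> x \<in> H \<Longrightarrow> \<kappa> (dv f) x = f x"
  using theI'[OF killing_represents[of f]] unfolding dual_vector_def by blast+

lemma dual_vector_eqI: "f \<in> V \<Longrightarrow> t \<in> H \<Longrightarrow> (\<And>x. x \<in> H \<Longrightarrow> \<kappa> t x = f x) \<Longrightarrow> dv f = t"
  using killing_represents[of f] dual_vector_in_H[of f] killing_dual_vector[of f] by blast

lemma dual_form_eq: "f \<in> V \<Longrightarrow> k \<in> V \<Longrightarrow> B f k = f (dv k)"
  unfolding dual_form_def by (simp add: killing_dual_vector dual_vector_in_H)

lemma dual_space_add_smult: "f \<in> V \<Longrightarrow> k \<in> V \<Longrightarrow> (\<lambda>x. f x + c * k x) \<in> V"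
  by (auto simp: dual_space_def algebra_simps)

lemma root_in_dual: "a \<in> \<Delta> \<Longrightarrow> a \<in> V"
  by (simp add: roots_def)

lemma br_root_space:
  assumes "x \<in> root_space scale br H a" "y \<in> root_space scale br H b"
  shows "br x y \<in> root_space scale br H (\<lambda>z. a z + b z)"
  unfolding root_space_def
proof safe
  fix z assume z: "z \<in> H"
  have "br z (br x y) = br (br z x) y + br x (br z y)" by (simp add: br_br)
  also have "\<dots> = scale (a z + b z) (br x y)"
    using assms z by (simp add: root_space_def br_scale_left br.scale scale_left_distrib)
  finally show "br z (br x y) = scale (a z + b z) (br x y)" .
qed

lemma funpow_br_root_space:
  assumes "x \<in> root_space scale br H a" "y \<in> root_space scale br H b"
  shows "(br x ^^ n) y \<in> root_space scale br H (\<lambda>z. b z + of_nat n * a z)"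
proof (induction n)
  case (Suc n)
  show ?case using br_root_space[OF assms(1) Suc] by (simp add: algebra_simps)
qed (use assms in simp)

text \<open>A weight vector z that pairs nontrivially with \<open>e\<close> must have weight -a by
  invariance. Then [e, z] centralizes \<open>H\<close>, hence lies in \<open>H\<close>, and
  invariance shows that it is a multiple of the dual vector of \<open>a\<close>.\<close>

lemma root_sl2_triple:
  assumes a: "a \<in> \<Delta>" and "B a a \<noteq> 0"
  obtains e f h where "e \<in> root_space scale br H a" "f \<in> root_space scale br H (\<lambda>x. - a x)"
    "br e f = h" "br h e = scale 2 e" "br h f = scale (- 2) f" "h \<in> H"
    "\<And>b. b \<in> V \<Longrightarrow> b h = 2 * B b a / B a a"
proof -
  have aV: "a \<in> V" using a by (rule root_in_dual)
  have "0 \<in> root_space scale br H a" by (simp add: root_space_def)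
  then obtain e where e: "e \<in> root_space scale br H a" "e \<noteq> 0"
    using a by (auto simp: roots_def)
  obtain z where z: "\<forall>y\<in>H. \<exists>c. br y z = scale c z" "\<kappa> e z \<noteq> 0"
    using killing_eqI[of e] e by blast
  have neg: "br y z = scale (- a y) z" if y: "y \<in> H" for y
  proof -
    obtain c where c: "br y z = scale c z" using z y by blast
    have "a y * \<kappa> e z = \<kappa> (br y e) z" using e y by (simp add: root_space_def killing_scale_left)
    also have "\<dots> = - \<kappa> (br e y) z"
      using killing_diff_left[of 0 "br e y" z] by (simp add: br_commute[of y e])
    also have "\<dots> = - c * \<kappa> e z" by (simp add: killing_br_left c killing_scale_right)
    finally have "c = - a y" using z(2) by (simp add: eq_neg_iff_add_eq_0 add.commute flip: distrib_right)
    then show ?thesis using c by simp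
  qed
  have ez: "br e z \<in> H"
  proof (rule H_self_centralizing)
    fix y assume y: "y \<in> H"
    have "br y (br e z) = br (br y e) z + br e (br y z)" by (simp add: br_br)
    also have "\<dots> = 0" using e(1) neg[OF y] y by (simp add: root_space_def br_scale_left br.scale br.neg)
    finally show "br y (br e z) = 0" .
  qed
  have kez: "\<kappa> (br e z) y = a y * \<kappa> e z" if "y \<in> H" for y
  proof -
    have "br z y = scale (a y) z" using neg[OF that] br_commute[of z y] by simp
    then show ?thesis by (simp add: killing_br_left killing_scale_right)
  qed
  have dva: "dv a = scale (1 / \<kappa> e z) (br e z)"
    using ez z(2) kez subspace_H
    by (intro dual_vector_eqI[OF aV]) (auto simp: subspace_scale killing_scale_left)
  \<comment> \<open>The scaling is chosen so that [e, f] becomes the coroot, on which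
    \<open>a\<close> takes the value 2.\<close>
  define f where "f = scale (2 / (B a a * \<kappa> e z)) z"
  define h where "h = scale (2 / B a a) (dv a)"
  have ef: "br e f = h" by (simp add: f_def h_def dva br.scale)
  have hH: "h \<in> H" using dual_vector_in_H[OF aV] subspace_H by (simp add: h_def subspace_scale)
  have bh: "b h = 2 * B b a / B a a" if "b \<in> V" for b
  proof -
    have "b h = 2 / B a a * b (dv a)"
      using that dual_vector_in_H[OF aV] by (simp add: dual_space_def h_def)
    then show ?thesis using dual_form_eq[OF that aV] by simp
  qed
  have ah: "a h = 2" using bh[OF aV] \<open>B a a \<noteq> 0\<close> by simp
  have "br h z = scale (- 2) z" using neg[OF hH] ah by simp
  then have "br h f = scale (- 2) f" by (simp add: f_def br.scale)
  moreover have "br h e = scale 2 e" using e(1) hH ah by (simp add: root_space_def)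
  moreover have "f \<in> root_space scale br H (\<lambda>x. - a x)"
    using neg by (auto simp: root_space_def f_def br.scale)
  ultimately show ?thesis using that e(1) ef hH bh by blast
qed

text \<open>A root vector for \<open>b\<close> has weight k under the coroot of \<open>a\<close>; a
  string vector of weight -k lies in the root space of b - k a. The new functional is not 0:
  otherwise evaluation at the coroot gives k = 2k, so k = 0 and b = 0.\<close>

lemma root_reflection:
  assumes a: "a \<in> \<Delta>" and b: "b \<in> \<Delta>" and "B a a \<noteq> 0"
    and int: "2 * B b a / B a a = of_int k"
  shows "(\<lambda>x. b x - of_int k * a x) \<in> \<Delta>"
proof -
  have V: "a \<in> V" "b \<in> V" using a b by (simp_all add: root_in_dual)
  obtain e f h where efh: "e \<in> root_space scale br H a" "f \<in> root_space scale br H (\<lambda>x. - a x)"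
    "br e f = h" "br h e = scale 2 e" "br h f = scale (- 2) f" "h \<in> H"
    and hb: "\<And>b. b \<in> V \<Longrightarrow> b h = 2 * B b a / B a a"
    using root_sl2_triple[OF a assms(3)] by blast
  have "0 \<in> root_space scale br H b" by (simp add: root_space_def)
  then obtain x where x: "x \<in> root_space scale br H b" "x \<noteq> 0" using b by (auto simp: roots_def)
  have ah: "a h = 2" using hb[OF V(1)] assms(3) by simp
  have bh: "b h = of_int k" using hb[OF V(2)] int by simp
  have hx: "br h x = scale (of_int k) x" using x(1) efh(6) bh by (simp add: root_space_def)
  let ?r = "\<lambda>x. b x - of_int k * a x"
  have "\<exists>y \<in> root_space scale br H ?r. y \<noteq> 0"
  proof (cases "k \<ge> 0")
    case True
    then obtain m where m: "k = int m" using nonneg_int_cases by blast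
    have hm: "br h x = scale (of_nat m) x" using hx m by simp
    obtain q where q: "(br f ^^ (m + q)) ((br e ^^ q) x) \<noteq> 0"
      using sl2_string_nonzero[OF efh(3-5) hm x(2)] by blast
    have "(br f ^^ (m + q)) ((br e ^^ q) x) \<in> root_space scale br H ?r"
      using funpow_br_root_space[OF efh(2) funpow_br_root_space[OF efh(1) x(1)], of "m + q" q] m
      by (simp add: algebra_simps)
    then show ?thesis using q by blast
  next
    case False
    then obtain m where m: "k = - int m" by (metis int_cases2 of_nat_0_le_iff)
    have hm: "br (- h) x = scale (of_nat m) x" using hx m by (simp add: br_minus_left)
    \<comment> \<open>For negative k the string runs the other way: (f, e, -h) is again an sl2
      triple.\<close>
    have "br f e = - h" using efh(3) br_commute[of f e] by simp
    moreover have "br (- h) f = scale 2 f" "br (- h) e = scale (- 2) e"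
      using efh by (simp_all add: br_minus_left)
    ultimately obtain q where q: "(br e ^^ (m + q)) ((br f ^^ q) x) \<noteq> 0"
      using sl2_string_nonzero[where e = f and f = e and h = "- h"] hm x(2) by blast
    have "(br e ^^ (m + q)) ((br f ^^ q) x) \<in> root_space scale br H ?r"
      using funpow_br_root_space[OF efh(1) funpow_br_root_space[OF efh(2) x(1)], of "m + q" q] m
      by (simp add: algebra_simps)
    then show ?thesis using q by blast
  qed
  moreover have "?r \<in> V" using dual_space_add_smult[OF V(2,1), of "- of_int k"] by simp
  moreover have "?r \<noteq> (\<lambda>_. 0)"
  proof
    assume "?r = (\<lambda>_. 0)"
    from fun_cong[OF this, of h] have "of_int k = (0 :: complex)" using ah bh by simp
    then show False using \<open>?r = (\<lambda>_. 0)\<close> b by (simp add: roots_def)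
  qed
  ultimately show ?thesis unfolding roots_def by blast
qed

section \<open>Functionals on the Cartan subalgebra as combinations of simple roots\<close>

lemma dual_space_zero: "(\<lambda>x. 0) \<in> V"
  by (simp add: dual_space_def)

lemma dual_space_sum:
  assumes "\<And>i. i \<in> I \<Longrightarrow> \<alpha> i \<in> V"
  shows "(\<lambda>x. \<Sum>i\<in>I. c i * \<alpha> i x) \<in> V"
  using assms
proof (induction I rule: infinite_finite_induct)
  case (insert i I)
  then have "(\<lambda>x. (\<Sum>i\<in>I. c i * \<alpha> i x) + c i * \<alpha> i x) \<in> V"
    by (intro dual_space_add_smult) auto
  then show ?case using insert by (simp add: add.commute)
qed (simp_all add: dual_space_zero)

lemma dual_form_sum_left:
  assumes "\<And>i. i \<in> I \<Longrightarrow> \<alpha> i \<in> V" "a \<in> V"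
  shows "B (\<lambda>x. \<Sum>i\<in>I. c i * \<alpha> i x) a = (\<Sum>i\<in>I. c i * B (\<alpha> i) a)"
  using assms by (simp add: dual_form_eq dual_space_sum)

text \<open>Elements of the dual are bare functions, so dimension is counted in \<open>H\<close>:
  the dual vectors inherit independence, there are dim H of them, and an expansion of the dual
  vector of \<open>f\<close> is an expansion of \<open>f\<close>.\<close>

lemma dual_space_basis:
  assumes "finite I" "card I = dim H" and V: "\<And>i. i \<in> I \<Longrightarrow> \<alpha> i \<in> V"
    and indep: "\<And>c. (\<And>x. (\<Sum>i\<in>I. c i * \<alpha> i x) = 0) \<Longrightarrow> \<forall>i\<in>I. c i = 0"
    and "f \<in> V"
  shows "\<exists>c. f = (\<lambda>x. \<Sum>i\<in>I. c i * \<alpha> i x)"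
proof -
  define t where "t i = dv (\<alpha> i)" for i
  have tH: "t i \<in> H" if "i \<in> I" for i using V[OF that] by (simp add: t_def dual_vector_in_H)
  have kt: "\<kappa> (t i) x = \<alpha> i x" if "i \<in> I" "x \<in> H" for i x
    using V[OF that(1)] that(2) by (simp add: t_def killing_dual_vector)
  have off: "\<alpha> i x = 0" if "i \<in> I" "x \<notin> H" for i x
    using V[OF that(1)] that(2) by (simp add: dual_space_def)
  have lin: "c i = 0" if "(\<Sum>i\<in>I. scale (c i) (t i)) = 0" "i \<in> I" for c i
  proof -
    have "(\<Sum>i\<in>I. c i * \<alpha> i x) = 0" for x
    proof (cases "x \<in> H")
      case True
      have "0 = \<kappa> (\<Sum>i\<in>I. scale (c i) (t i)) x" using that(1) by simp
      then show ?thesis using True by (simp add: killing_sum_left killing_scale_left kt)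
    qed (simp add: off)
    from indep[OF this] that(2) show ?thesis by simp
  qed
  have inj: "inj_on t I"
  proof (rule inj_onI, rule ccontr)
    fix i j assume ij: "i \<in> I" "j \<in> I" "t i = t j" "i \<noteq> j"
    let ?c = "\<lambda>k. if k = i then 1 else if k = j then - 1 else 0"
    have c: "(\<Sum>k\<in>I. scale (?c k) (t k)) = (\<Sum>k\<in>{i, j}. scale (?c k) (t k))"
      using ij \<open>finite I\<close> by (intro sum.mono_neutral_right) auto
    have "(\<Sum>k\<in>I. scale (?c k) (t k)) = 0" unfolding c using ij by simp
    from lin[OF this ij(1)] show False by simp
  qed
  have "independent (t ` I)"
  proof (rule independent_if_scalars_zero)
    show "finite (t ` I)" using \<open>finite I\<close> by simp
    fix u x assume "(\<Sum>x\<in>t ` I. scale (u x) x) = 0" "x \<in> t ` I"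
    then have "(\<Sum>i\<in>I. scale (u (t i)) (t i)) = 0" by (simp add: sum.reindex[OF inj])
    moreover obtain i where "i \<in> I" "x = t i" using \<open>x \<in> t ` I\<close> by (elim imageE)
    ultimately show "u x = 0" using lin[of "\<lambda>i. u (t i)" i] by simp
  qed
  then have "H \<subseteq> span (t ` I)"
    using tH card_image[OF inj] \<open>card I = dim H\<close>
    by (intro card_ge_dim_independent image_subsetI) simp_all
  then have "dv f \<in> span (t ` I)" using dual_vector_in_H[OF \<open>f \<in> V\<close>] by blast
  then obtain u where "dv f = (\<Sum>x\<in>t ` I. scale (u x) x)"
    unfolding span_finite[OF finite_imageI[OF \<open>finite I\<close>]] by (elim rangeE)
  then have dvf: "dv f = (\<Sum>i\<in>I. scale (u (t i)) (t i))" by (simp add: sum.reindex[OF inj])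
  have "f x = (\<Sum>i\<in>I. u (t i) * \<alpha> i x)" for x
  proof (cases "x \<in> H")
    case True
    then have "f x = \<kappa> (dv f) x" by (simp add: killing_dual_vector[OF \<open>f \<in> V\<close>])
    also have "\<dots> = (\<Sum>i\<in>I. u (t i) * \<alpha> i x)"
      unfolding dvf using True by (simp add: killing_sum_left killing_scale_left kt)
    finally show ?thesis .
  next
    case False
    then show ?thesis using \<open>f \<in> V\<close> by (simp add: dual_space_def off)
  qed
  then have "f = (\<lambda>x. \<Sum>i\<in>I. u (t i) * \<alpha> i x)" by (rule ext)
  then show ?thesis by (intro exI[of _ "\<lambda>i. u (t i)"])
qed

end

section \<open>The action on the Coxeter plane\<close>

locale bipartite_cartan_matrix =
  fixes I1 I2 :: "'i set" and C :: "'i \<Rightarrow> 'i \<Rightarrow> complex" and v :: "'i \<Rightarrow> real" and g :: nat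
  assumes fin: "finite I1" "finite I2" and disj: "I1 \<inter> I2 = {}"
    and diag: "\<And>i. i \<in> I1 \<union> I2 \<Longrightarrow> C i i = 2"
    and orth1: "\<And>i j. i \<in> I1 \<Longrightarrow> j \<in> I1 \<Longrightarrow> i \<noteq> j \<Longrightarrow> C i j = 0"
    and orth2: "\<And>i j. i \<in> I2 \<Longrightarrow> j \<in> I2 \<Longrightarrow> i \<noteq> j \<Longrightarrow> C i j = 0"
    and v_pos: "\<And>i. i \<in> I1 \<union> I2 \<Longrightarrow> 0 < v i"
    and g_pos: "0 < g"
    and eigenvector: "\<And>i. i \<in> I1 \<union> I2 \<Longrightarrow>
      (\<Sum>j\<in>I1 \<union> I2. C i j * of_real (v j)) = of_real ((2 - 2 * cos (pi / (2 * real g))) * v i)"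
begin

lemma swap: "bipartite_cartan_matrix I2 I1 C v g"
  by unfold_locales
    (use fin disj diag orth1 orth2 v_pos g_pos eigenvector in \<open>auto simp: Un_commute\<close>)

abbreviation \<theta> where "\<theta> \<equiv> pi / (2 * real g)"

text \<open>All coordinates in \<open>J\<close> change at once. For mutually orthogonal roots in
  \<open>J\<close> this is the product of the simple reflections, by
  \<open>refl_insert\<close>.\<close>

definition refl :: "'i set \<Rightarrow> ('i \<Rightarrow> complex) \<Rightarrow> 'i \<Rightarrow> complex" where
  "refl J c = (\<lambda>i. if i \<in> J then c i - (\<Sum>j\<in>I1 \<union> I2. c j * C j i) else c i)"

text \<open>Pairing with the positive eigenvector on one part; the weights of the two parts are the
  oblique coordinates of the projection to the Coxeter plane.\<close>

definition weight :: "'i set \<Rightarrow> ('i \<Rightarrow> complex) \<Rightarrow> complex" where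
  "weight J c = (\<Sum>i\<in>J. c i * of_real (v i))"

lemma refl_refl1 [simp]: "refl I1 (refl I1 c) = c"
  and refl1_eq: "i \<in> I1 \<Longrightarrow> refl I1 c i = - c i - (\<Sum>j\<in>I2. c j * C j i)"
  and weight1_refl1: "weight I1 (refl I1 c) = - weight I1 c + of_real (2 * cos \<theta>) * weight I2 c"
  and weight2_refl1: "weight I2 (refl I1 c) = weight I2 c"
proof -
  have eq: "refl I1 c i = - c i - (\<Sum>j\<in>I2. c j * C j i)" if i: "i \<in> I1" for i c
  proof -
    have "(\<Sum>j\<in>I1 \<union> I2. c j * C j i) = (\<Sum>j\<in>I1. c j * C j i) + (\<Sum>j\<in>I2. c j * C j i)"
      using fin disj by (simp add: sum.union_disjoint)
    also have "(\<Sum>j\<in>I1. c j * C j i) = (\<Sum>j\<in>I1. if j = i then c i * 2 else 0)"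
      using i orth1[of _ i] diag by (intro sum.cong) auto
    also have "\<dots> = c i * 2" using i fin by simp
    finally show ?thesis using i by (simp add: refl_def)
  qed
  then show "i \<in> I1 \<Longrightarrow> refl I1 c i = - c i - (\<Sum>j\<in>I2. c j * C j i)" .
  have same: "refl I1 c j = c j" if "j \<in> I2" for c j
    using that disj by (auto simp: refl_def)
  show "refl I1 (refl I1 c) = c"
  proof
    fix i
    show "refl I1 (refl I1 c) i = c i"
    proof (cases "i \<in> I1")
      case True
      then show ?thesis by (simp add: eq same)
    qed (simp add: refl_def)
  qed
  show "weight I2 (refl I1 c) = weight I2 c"
    by (simp add: weight_def same)
  \<comment> \<open>In a row belonging to \<open>I2\<close>, orthogonality leaves only the diagonal
    entry 2 inside \<open>I2\<close>. It cancels the 2 in the eigenvalue, so the entries in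
    \<open>I1\<close> account for -2 cos \<theta>.\<close>
  have col: "(\<Sum>i\<in>I1. C j i * of_real (v i)) = - of_real (2 * cos \<theta> * v j)" if j: "j \<in> I2" for j
  proof -
    have "(\<Sum>i\<in>I2. C j i * of_real (v i)) = (\<Sum>i\<in>I2. if i = j then 2 * of_real (v j) else 0)"
      using j orth2[of j] diag by (intro sum.cong) auto
    also have "\<dots> = 2 * of_real (v j)" using j fin by simp
    finally have "(\<Sum>i\<in>I1. C j i * of_real (v i))
        = (\<Sum>i\<in>I1 \<union> I2. C j i * of_real (v i)) - 2 * of_real (v j)"
      using fin disj by (simp add: sum.union_disjoint)
    also have "(\<Sum>i\<in>I1 \<union> I2. C j i * of_real (v i))
        = 2 * of_real (v j) - of_real (2 * cos \<theta> * v j)"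
      using eigenvector[of j] j by (simp add: left_diff_distrib)
    finally show ?thesis by simp
  qed
  have "(\<Sum>i\<in>I1. (\<Sum>j\<in>I2. c j * C j i) * of_real (v i))
      = (\<Sum>j\<in>I2. c j * (\<Sum>i\<in>I1. C j i * of_real (v i)))"
    unfolding sum_distrib_left sum_distrib_right by (subst sum.swap) (simp add: mult.assoc)
  also have "\<dots> = (\<Sum>j\<in>I2. - of_real (2 * cos \<theta>) * (c j * of_real (v j)))"
    by (intro sum.cong) (simp_all add: col)
  also have "\<dots> = - of_real (2 * cos \<theta>) * weight I2 c"
    by (simp only: weight_def sum_distrib_left)
  finally show "weight I1 (refl I1 c) = - weight I1 c + of_real (2 * cos \<theta>) * weight I2 c"
    by (simp add: weight_def eq left_diff_distrib sum_subtractf sum_negf)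
qed

lemma refl_refl2 [simp]: "refl I2 (refl I2 c) = c"
  and refl2_eq: "i \<in> I2 \<Longrightarrow> refl I2 c i = - c i - (\<Sum>j\<in>I1. c j * C j i)"
  and weight2_refl2: "weight I2 (refl I2 c) = - weight I2 c + of_real (2 * cos \<theta>) * weight I1 c"
  and weight1_refl2: "weight I1 (refl I2 c) = weight I1 c"
proof -
  interpret s: bipartite_cartan_matrix I2 I1 C v g by (rule swap)
  have r: "s.refl = refl"
    unfolding fun_eq_iff s.refl_def refl_def Un_commute[of I2 I1] by blast
  show "refl I2 (refl I2 c) = c" using s.refl_refl1[of c] unfolding r .
  show "refl I2 c i = - c i - (\<Sum>j\<in>I1. c j * C j i)" if "i \<in> I2"
    using s.refl1_eq[OF that, of c] unfolding r .
  show "weight I2 (refl I2 c) = - weight I2 c + of_real (2 * cos \<theta>) * weight I1 c"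
    using s.weight1_refl1[of c] unfolding r .
  show "weight I1 (refl I2 c) = weight I1 c" using s.weight2_refl1[of c] unfolding r .
qed

lemma refl_sum: "refl J (\<lambda>j. \<Sum>i\<in>A. a i * u i j) = (\<lambda>j. \<Sum>i\<in>A. a i * refl J (u i) j)"
proof
  fix j
  have "(\<Sum>k\<in>I1 \<union> I2. (\<Sum>i\<in>A. a i * u i k) * C k j) = (\<Sum>i\<in>A. a i * (\<Sum>k\<in>I1 \<union> I2. u i k * C k j))"
    unfolding sum_distrib_left sum_distrib_right by (subst sum.swap) (simp add: mult.assoc)
  then show "refl J (\<lambda>j. \<Sum>i\<in>A. a i * u i j) j = (\<Sum>i\<in>A. a i * refl J (u i) j)"
    by (simp add: refl_def right_diff_distrib sum_subtractf)
qed

lemma refl_uminus: "refl J (\<lambda>j. - c j) = (\<lambda>j. - refl J c j)"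
  by (auto simp: refl_def sum_negf)

lemma refl1_supported:
  assumes "\<And>j. j \<notin> I1 \<Longrightarrow> c j = 0"
  shows "refl I1 c = (\<lambda>i. - c i)"
proof
  fix i
  have "(\<Sum>j\<in>I2. c j * C j i) = 0" using assms disj by (intro sum.neutral) auto
  then show "refl I1 c i = - c i"
    using assms by (cases "i \<in> I1") (simp_all add: refl1_eq, simp add: refl_def)
qed

lemma refl2_supported:
  assumes "\<And>j. j \<notin> I2 \<Longrightarrow> c j = 0"
  shows "refl I2 c = (\<lambda>i. - c i)"
proof
  fix i
  have "(\<Sum>j\<in>I1. c j * C j i) = 0" using assms disj by (intro sum.neutral) auto
  then show "refl I2 c i = - c i"
    using assms by (cases "i \<in> I2") (simp_all add: refl2_eq, simp add: refl_def)
qed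

text \<open>Changing the coordinates in \<open>J\<close> does not affect the pairing with root i,
  because the entries \<open>C k i\<close> with k in \<open>J\<close> vanish.\<close>

lemma refl_insert:
  assumes "i \<notin> J" "\<And>k. k \<in> J \<Longrightarrow> C k i = 0"
  shows "refl (insert i J) c = refl {i} (refl J c)"
proof
  fix j
  have "(\<Sum>k\<in>I1 \<union> I2. refl J c k * C k i) = (\<Sum>k\<in>I1 \<union> I2. c k * C k i)"
    using assms(2) by (intro sum.cong) (auto simp: refl_def)
  then show "refl (insert i J) c j = refl {i} (refl J c) j"
    using assms(1) by (auto simp: refl_def)
qed

lemma refl_empty [simp]: "refl {} c = c"
  by (simp add: refl_def)

lemma refl_refl_single [simp]: "i \<in> I1 \<union> I2 \<Longrightarrow> refl {i} (refl {i} c) = c"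
proof
  fix j assume i: "i \<in> I1 \<union> I2"
  let ?s = "\<Sum>k\<in>I1 \<union> I2. c k * C k i"
  have "(\<Sum>k\<in>I1 \<union> I2. refl {i} c k * C k i) = (\<Sum>k\<in>I1 \<union> I2. c k * C k i - (if k = i then ?s * 2 else 0))"
    using diag[OF i] by (intro sum.cong) (auto simp: refl_def algebra_simps)
  also have "\<dots> = - ?s" using i fin by (simp add: sum_subtractf)
  finally show "refl {i} (refl {i} c) j = c j" by (auto simp: refl_def)
qed

section \<open>The Coxeter element in coordinates and its rotation of the plane\<close>

definition cox where "cox c = refl I2 (refl I1 c)"
definition cox_inv where "cox_inv c = refl I1 (refl I2 c)"

lemma cox_cox_inv [simp]: "cox (cox_inv c) = c" and cox_inv_cox [simp]: "cox_inv (cox c) = c"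
  by (simp_all add: cox_def cox_inv_def)

lemma cox_pow_cox_inv_pow [simp]: "(cox ^^ m) ((cox_inv ^^ m) c) = c"
proof (induction m arbitrary: c)
  case (Suc m)
  have "(cox ^^ Suc m) ((cox_inv ^^ Suc m) c) = cox ((cox ^^ m) ((cox_inv ^^ m) (cox_inv c)))"
    by (simp only: funpow.simps o_apply funpow_swap1)
  then show ?case by (simp only: Suc cox_cox_inv)
qed simp

lemma cox_inv_pow_cox_pow [simp]: "(cox_inv ^^ m) ((cox ^^ m) c) = c"
proof (induction m arbitrary: c)
  case (Suc m)
  have "(cox_inv ^^ Suc m) ((cox ^^ Suc m) c) = cox_inv ((cox_inv ^^ m) ((cox ^^ m) (cox c)))"
    by (simp only: funpow.simps o_apply funpow_swap1)
  then show ?case by (simp only: Suc cox_inv_cox)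
qed simp

lemma cox_inv_pow_sum:
  "(cox_inv ^^ m) (\<lambda>j. \<Sum>i\<in>A. a i * u i j) = (\<lambda>j. \<Sum>i\<in>A. a i * (cox_inv ^^ m) (u i) j)"
  by (induction m) (simp_all add: cox_inv_def refl_sum)

lemma cox_pow_uminus: "(cox ^^ m) (\<lambda>j. - c j) = (\<lambda>j. - (cox ^^ m) c j)"
  by (induction m) (simp_all add: cox_def refl_uminus)

text \<open>Dihedral relation: each of the two involutions conjugates their product to its
  inverse.\<close>

lemma refl1_cox_inv_pow: "refl I1 ((cox_inv ^^ m) c) = (cox ^^ m) (refl I1 c)"
  by (induction m arbitrary: c) (simp_all add: cox_def cox_inv_def funpow_swap1)

lemma refl2_cox_inv_pow: "refl I2 ((cox_inv ^^ m) c) = (cox ^^ m) (refl I2 c)"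
  by (induction m arbitrary: c) (simp_all add: cox_def cox_inv_def funpow_swap1)

text \<open>
  The projection to the Coxeter plane sends \<open>\<alpha>\<^sub>i\<close> to \<open>v\<^sub>i\<close> (for \<open>i \<in> I1\<close>) or
  \<open>v\<^sub>i e\<^bsup>\<i>(\<pi> - \<theta>)\<^esup>\<close> (for \<open>i \<in> I2\<close>), up to scaling; \<open>height t\<close> is the imaginary part of this
  projection after rotation by \<open>t\<close>. The two reflections act on the plane as reflections, and the
  inverse Coxeter element as rotation by \<open>2\<theta>\<close>.
\<close>

definition height :: "real \<Rightarrow> ('i \<Rightarrow> complex) \<Rightarrow> complex" where
  "height t c = of_real (sin t) * weight I1 c + of_real (sin (\<theta> - t)) * weight I2 c"

text \<open>On the angle t the two factors act as t \<mapsto> -t and t \<mapsto> 2\<theta> - t;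
  composing them shifts t by 2\<theta>.\<close>

lemma height_refl1: "height t (refl I1 c) = height (- t) c"
proof -
  have "sin (\<theta> + t) = sin (\<theta> - t) + 2 * cos \<theta> * sin t"
    by (simp add: sin_add sin_diff)
  then show ?thesis
    by (simp add: height_def weight1_refl1 weight2_refl1 algebra_simps flip: of_real_mult of_real_add)
      (simp add: algebra_simps)
qed

lemma height_refl2: "height t (refl I2 c) = height (2 * \<theta> - t) c"
proof -
  have "sin (2 * \<theta> - t) = sin (\<theta> + (\<theta> - t))" by (simp add: algebra_simps)
  also have "\<dots> = sin (\<theta> - (\<theta> - t)) + 2 * cos \<theta> * sin (\<theta> - t)"
    unfolding sin_add[of \<theta>] sin_diff[of \<theta> "\<theta> - t"] by simp
  finally have s: "sin (2 * \<theta> - t) = sin t + 2 * cos \<theta> * sin (\<theta> - t)" by simp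
  have "\<theta> - (2 * \<theta> - t) = - (\<theta> - t)" by simp
  then have "sin (\<theta> - (2 * \<theta> - t)) = - sin (\<theta> - t)" by (metis sin_minus)
  with s show ?thesis
    by (simp only: height_def weight2_refl2 weight1_refl2 of_real_add of_real_mult of_real_minus)
      (simp add: algebra_simps)
qed

lemma height_cox_inv_pow: "height t ((cox_inv ^^ m) c) = height (t + 2 * real m * \<theta>) c"
proof (induction m arbitrary: t)
  case (Suc m)
  have "height t ((cox_inv ^^ Suc m) c) = height (2 * \<theta> - - t) ((cox_inv ^^ m) c)"
    by (simp only: funpow.simps o_apply cox_inv_def[of "(cox_inv ^^ m) c"] height_refl1 height_refl2)
  also have "\<dots> = height (2 * \<theta> - - t + 2 * real m * \<theta>) c" by (rule Suc)
  also have "2 * x - - t + 2 * real m * x = t + 2 * real (Suc m) * x" for x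
    by (simp add: algebra_simps)
  finally show ?case .
qed simp

definition base :: "'i \<Rightarrow> 'i \<Rightarrow> complex" where
  "base i = (\<lambda>j. if j = i then if i \<in> I1 then 1 else - 1 else 0)"

text \<open>The direction of \<beta> i in the plane. The minus sign for \<open>I2\<close> turns the
  direction \<pi> - \<theta> of the simple root into -\<theta>, just below the direction 0 of the
  roots in \<open>I1\<close>.\<close>

definition phase :: "'i \<Rightarrow> real" where
  "phase i = (if i \<in> I1 then 0 else - \<theta>)"

lemma height_base:
  assumes i: "i \<in> I1 \<union> I2"
  shows "height t (base i) = of_real (v i * sin (t + phase i))"
proof -
  have w: "weight J (base i) = (if i \<in> J then base i i * of_real (v i) else 0)" if "finite J" for J
  proof -
    have "weight J (base i) = (\<Sum>j\<in>J. if j = i then base i i * of_real (v i) else 0)"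
      unfolding weight_def by (intro sum.cong) (auto simp: base_def)
    then show ?thesis using that by simp
  qed
  have "sin (\<theta> - t) = - sin (t - \<theta>)" by (metis minus_diff_eq sin_minus)
  moreover have "base i i = (if i \<in> I1 then 1 else - 1)" by (simp add: base_def)
  ultimately show ?thesis
    using i disj fin by (auto simp: height_def w phase_def)
qed

lemma height_orbit:
  assumes "i \<in> I1 \<union> I2"
  shows "height t ((cox_inv ^^ m) (base i)) = of_real (v i * sin (t + phase i + 2 * real m * \<theta>))"
  using height_base[OF assms, of "t + 2 * real m * \<theta>"]
  by (simp add: height_cox_inv_pow algebra_simps)

lemma \<theta>_bounds: "0 < \<theta>" "\<theta> < pi"
  using g_pos by (simp_all add: field_simps)

lemma orbit_eq_imp_mod_eq:
  assumes i: "i \<in> I1 \<union> I2" and j: "j \<in> I1 \<union> I2"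
    and eq: "(cox_inv ^^ m) (base i) = (cox_inv ^^ n) (base j)"
  shows "m mod (2 * g) = n mod (2 * g)"
proof -
  define x where "x = phase i + 2 * real m * \<theta> - (phase j + 2 * real n * \<theta>)"
  have vs: "v i * sin (t + phase i + 2 * real m * \<theta>) = v j * sin (t + phase j + 2 * real n * \<theta>)" for t
    using height_orbit[OF i, of t m] height_orbit[OF j, of t n] eq by (metis of_real_eq_iff)
  \<comment> \<open>Rotating the second point to direction 0 makes the right side vanish; a quarter
    turn further it equals v j > 0. Together sin x = 0 and cos x > 0, so the directions agree modulo
    2\<pi>.\<close>
  have "v i * sin x = 0"
    using vs[of "- (phase j + 2 * real n * \<theta>)"] by (simp add: x_def algebra_simps)
  then have sx: "sin x = 0" using v_pos[OF i] by simp
  have "v i * sin (pi / 2 + x) = v j * sin (pi / 2)"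
    using vs[of "pi / 2 - (phase j + 2 * real n * \<theta>)"] by (simp add: x_def algebra_simps)
  then have "v i * cos x = v j" by (simp add: sin_add)
  then have cx: "0 < cos x" using v_pos[OF i] v_pos[OF j] by (metis zero_less_mult_pos)
  have "cos x = 1" using sx cx sin_cos_squared_add[of x] by (simp add: power2_eq_1_iff)
  then obtain k :: int where k: "x = real_of_int k * 2 * pi" using cos_one_2pi_int by blast
  define d :: "'i \<Rightarrow> int" where "d l = (if l \<in> I1 then 0 else 1)" for l
  have ph: "phase l = - real_of_int (d l) * \<theta>" for l by (simp add: phase_def d_def)
  have "x = real_of_int (2 * int m - 2 * int n - d i + d j) * \<theta>"
    by (simp add: x_def ph algebra_simps)
  moreover have "x = real_of_int (4 * int g * k) * \<theta>" using g_pos by (simp add: k)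
  ultimately have "real_of_int (2 * int m - 2 * int n - d i + d j) = real_of_int (4 * int g * k)"
    using \<theta>_bounds(1) by (metis mult_cancel_right less_irrefl)
  then have int: "2 * int m - 2 * int n - d i + d j = 4 * int g * k" by (simp only: of_int_eq_iff)
  \<comment> \<open>In units of \<theta>, orbits from \<open>I1\<close> sit at even multiples and
    those from \<open>I2\<close> at odd ones, and a full turn is 4g, so equal directions force equal
    parts.\<close>
  then have "d i - d j = 2 * (int m - int n - 2 * int g * k)" by simp
  then have "even (d i - d j)" by simp
  then have dij: "d i = d j" by (auto simp: d_def split: if_splits)
  with int have "2 * (int m - int n) = 2 * (k * int (2 * g))" by simp
  then have "int m - int n = k * int (2 * g)" by (simp only: mult_cancel_left) simp
  then have "int m mod int (2 * g) = int n mod int (2 * g)" by (metis mod_eq_dvd_iff dvd_triv_right)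
  then show ?thesis by (metis of_nat_eq_iff zmod_int)
qed

end

section \<open>Signs along an orbit, its period, and separation of orbits\<close>

locale bipartite_root_coordinates = bipartite_cartan_matrix I1 I2 C v g
  for I1 I2 :: "'i set" and C :: "'i \<Rightarrow> 'i \<Rightarrow> complex" and v :: "'i \<Rightarrow> real" and g :: nat +
  fixes R :: "('i \<Rightarrow> complex) set"
  assumes base_in_R: "\<And>i. i \<in> I1 \<union> I2 \<Longrightarrow> base i \<in> R"
    and refl1_in_R: "\<And>c. c \<in> R \<Longrightarrow> refl I1 c \<in> R"
    and refl2_in_R: "\<And>c. c \<in> R \<Longrightarrow> refl I2 c \<in> R"
    and R_supported: "\<And>c i. c \<in> R \<Longrightarrow> i \<notin> I1 \<union> I2 \<Longrightarrow> c i = 0"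
    and R_sign: "\<And>c. c \<in> R \<Longrightarrow> (\<forall>i\<in>I1 \<union> I2. c i \<in> \<nat>) \<or> (\<forall>i\<in>I1 \<union> I2. - c i \<in> \<nat>)"
begin

lemma orbit_in_R: "i \<in> I1 \<union> I2 \<Longrightarrow> (cox_inv ^^ m) (base i) \<in> R"
  by (induction m) (auto simp: cox_inv_def base_in_R refl1_in_R refl2_in_R)

text \<open>Coefficients are complex numbers, so nonnegativity is carried by a real witness r.
  Positivity of \<open>v\<close> excludes cancellation, which gives the clause for r = 0.\<close>

lemma weight_Nats:
  assumes "\<And>i. i \<in> J \<Longrightarrow> c i \<in> \<nat>" "J \<subseteq> I1 \<union> I2"
  shows "\<exists>r \<ge> 0. weight J c = of_real r \<and> (r = 0 \<longrightarrow> (\<forall>i\<in>J. c i = 0))"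
proof -
  have "\<forall>i\<in>J. \<exists>n. c i = of_nat n" using assms(1) by (auto elim!: Nats_cases)
  then obtain n where n: "\<And>i. i \<in> J \<Longrightarrow> c i = of_nat (n i)" by metis
  have fJ: "finite J" using assms(2) fin by (meson finite_UnI finite_subset)
  have nn: "0 \<le> real (n i) * v i" if "i \<in> J" for i
    using that v_pos[of i] assms(2) by (simp add: subset_iff less_imp_le)
  have "weight J c = of_real (\<Sum>i\<in>J. real (n i) * v i)"
    by (simp add: weight_def n)
  moreover have "0 \<le> (\<Sum>i\<in>J. real (n i) * v i)" using nn by (rule sum_nonneg)
  moreover have "c i = 0" if "(\<Sum>i\<in>J. real (n i) * v i) = 0" "i \<in> J" for i
  proof -
    have "real (n i) * v i = 0" using that sum_nonneg_eq_0_iff[OF fJ, of "\<lambda>i. real (n i) * v i"] nn by simp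
    moreover have "0 < v i" using that(2) assms(2) v_pos by blast
    ultimately show ?thesis using n[OF that(2)] by simp
  qed
  ultimately show ?thesis by blast
qed

lemma weight_uminus: "weight J (\<lambda>i. - c i) = - weight J c"
  by (simp add: weight_def sum_negf)

lemma weight_eq_0D:
  assumes "c \<in> R" "J \<subseteq> I1 \<union> I2" "weight J c = 0" "i \<in> J"
  shows "c i = 0"
proof -
  from R_sign[OF assms(1)] consider "\<And>i. i \<in> J \<Longrightarrow> c i \<in> \<nat>" | "\<And>i. i \<in> J \<Longrightarrow> - c i \<in> \<nat>"
    using assms(2) by blast
  then show ?thesis
  proof cases
    case 1
    then show ?thesis using weight_Nats[of J c] assms by auto
  next
    case 2
    then show ?thesis using weight_Nats[of J "\<lambda>i. - c i"] assms by (auto simp: weight_uminus)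
  qed
qed

text \<open>At t = \<theta>/2 both weights are multiplied by the same nonnegative number sin
  (\<theta>/2), so the height is a nonnegative multiple of their sum.\<close>

lemma height_Nats:
  assumes "\<forall>i\<in>I1 \<union> I2. c i \<in> \<nat>"
  shows "\<exists>r \<ge> 0. height (\<theta> / 2) c = of_real r"
proof -
  obtain r s where rs: "weight I1 c = of_real r" "weight I2 c = of_real s" "0 \<le> r" "0 \<le> s"
    using weight_Nats[of I1 c] weight_Nats[of I2 c] assms by auto
  have "0 \<le> sin (x / 2)" if "0 < x" "x < pi" for x :: real
    using that by (intro sin_ge_zero) linarith+
  from this[OF \<theta>_bounds] have "0 \<le> sin (\<theta> / 2)" .
  moreover have "\<theta> - \<theta> / 2 = \<theta> / 2" by simp
  ultimately show ?thesis
    using rs by (intro exI[of _ "sin (\<theta> / 2) * (r + s)"]) (simp only: height_def, simp add: distrib_left)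
qed

text \<open>A nonnegative root has height \<ge> 0, a nonpositive one height \<le> 0, and every root
  is one or the other; off the dividing line the sign of the height therefore decides.\<close>

lemma orbit_sign:
  assumes i: "i \<in> I1 \<union> I2"
    and nz: "sin (\<theta> / 2 + phase i + 2 * real m * \<theta>) \<noteq> 0"
  shows "(\<forall>j\<in>I1 \<union> I2. (cox_inv ^^ m) (base i) j \<in> \<nat>)
    \<longleftrightarrow> 0 < sin (\<theta> / 2 + phase i + 2 * real m * \<theta>)" (is "?P \<longleftrightarrow> 0 < ?s")
proof -
  let ?c = "(cox_inv ^^ m) (base i)"
  have h: "height (\<theta> / 2) ?c = of_real (v i * ?s)" by (rule height_orbit[OF i])
  have "0 \<le> v i * ?s" if ?P
    using height_Nats[OF that] h by (metis of_real_eq_iff)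
  moreover have "0 \<le> - (v i * ?s)" if "\<forall>j\<in>I1 \<union> I2. - ?c j \<in> \<nat>"
  proof -
    have "height (\<theta> / 2) (\<lambda>j. - ?c j) = - height (\<theta> / 2) ?c"
      by (simp add: height_def weight_uminus)
    also have "\<dots> = of_real (- (v i * ?s))" by (simp only: h of_real_minus)
    finally show ?thesis using height_Nats[OF that] by (metis of_real_eq_iff)
  qed
  moreover have "?P \<or> (\<forall>j\<in>I1 \<union> I2. - ?c j \<in> \<nat>)"
    by (rule R_sign[OF orbit_in_R[OF i]])
  ultimately show ?thesis
    using v_pos[OF i] nz by (auto simp: zero_le_mult_iff mult_le_0_iff)
qed

text \<open>The angle is 4m + 1 units of \<theta>/2, and \<pi> is 4g such units. Being odd, 4m + 1
  avoids all multiples of 4g, and it is below 4g exactly when m < g.\<close>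

lemma orbit1_positive_iff:
  assumes i: "i \<in> I1" and m: "m < 2 * g"
  shows "(\<forall>j\<in>I1 \<union> I2. (cox_inv ^^ m) (base i) j \<in> \<nat>) \<longleftrightarrow> m < g"
proof -
  have "x / 2 + 0 + 2 * real m * x = (4 * real m + 1) * (x / 2)" for x :: real
    by (simp add: field_simps)
  from this[of \<theta>] have x: "\<theta> / 2 + phase i + 2 * real m * \<theta> = (4 * real m + 1) * (\<theta> / 2)"
    using i by (simp only: phase_def if_True)
  have gt: "pi = 4 * real g * (\<theta> / 2)" using g_pos by simp
  have t: "0 < \<theta> / 2" using \<theta>_bounds(1) by simp
  show ?thesis
  proof (cases "m < g")
    case True
    have "0 < sin ((4 * real m + 1) * (\<theta> / 2))"
    proof (rule sin_gt_zero)
      show "0 < (4 * real m + 1) * (\<theta> / 2)" using t by (intro mult_pos_pos) auto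
      have "4 * real m + 1 < 4 * real g" using True by linarith
      then show "(4 * real m + 1) * (\<theta> / 2) < pi" using t gt by (metis mult_strict_right_mono)
    qed
    then show ?thesis using True orbit_sign[of i m] i x by auto
  next
    case False
    have "sin ((4 * real m + 1) * (\<theta> / 2)) < 0"
    proof (rule sin_lt_zero)
      have "4 * real g < 4 * real m + 1" using False by linarith
      then show "pi < (4 * real m + 1) * (\<theta> / 2)" using t gt by (metis mult_strict_right_mono)
      have "4 * real m + 1 < 2 * (4 * real g)" using m by linarith
      then show "(4 * real m + 1) * (\<theta> / 2) < 2 * pi"
        using t gt by (metis mult.assoc mult_strict_right_mono)
    qed
    then show ?thesis using False orbit_sign[of i m] i x by auto
  qed
qed

text \<open>Here the angle is 4m - 1 units of \<theta>/2. The interval is shifted by one against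
  \<open>I1\<close>: step 0 is the negative root \<beta> i, while step g still falls short of
  \<pi>.\<close>

lemma orbit2_positive_iff:
  assumes i: "i \<in> I2" and m: "m < 2 * g"
  shows "(\<forall>j\<in>I1 \<union> I2. (cox_inv ^^ m) (base i) j \<in> \<nat>) \<longleftrightarrow> 1 \<le> m \<and> m \<le> g"
proof -
  have i1: "i \<notin> I1" using i disj by auto
  have "x / 2 + - x + 2 * real m * x = (4 * real m - 1) * (x / 2)" for x :: real
    by (simp add: field_simps)
  from this[of \<theta>] have x: "\<theta> / 2 + phase i + 2 * real m * \<theta> = (4 * real m - 1) * (\<theta> / 2)"
    using i1 by (simp only: phase_def if_False)
  have gt: "pi = 4 * real g * (\<theta> / 2)" using g_pos by simp
  have t: "0 < \<theta> / 2" using \<theta>_bounds(1) by simp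
  consider "m = 0" | "1 \<le> m" "m \<le> g" | "g < m" by linarith
  then show ?thesis
  proof cases
    case 1
    have "(- 1 :: complex) \<notin> \<nat>"
    proof
      assume "(- 1 :: complex) \<in> \<nat>"
      then obtain n where "- 1 = (of_nat n :: complex)" by (elim Nats_cases)
      then have "of_nat (n + 1) = (0 :: complex)" by (metis add.commute add.right_inverse of_nat_1 of_nat_add)
      then show False by (simp only: of_nat_eq_0_iff)
    qed
    moreover have "base i i = - 1" using i disj by (auto simp: base_def)
    ultimately have "base i i \<notin> \<nat>" by simp
    then show ?thesis using 1 i by auto
  next
    case 2
    have "0 < sin ((4 * real m - 1) * (\<theta> / 2))"
    proof (rule sin_gt_zero)
      show "0 < (4 * real m - 1) * (\<theta> / 2)" using t 2 by (intro mult_pos_pos) auto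
      have "4 * real m - 1 < 4 * real g" using 2 by linarith
      then show "(4 * real m - 1) * (\<theta> / 2) < pi" using t gt by (metis mult_strict_right_mono)
    qed
    then show ?thesis using 2 orbit_sign[of i m] i x by auto
  next
    case 3
    have "sin ((4 * real m - 1) * (\<theta> / 2)) < 0"
    proof (rule sin_lt_zero)
      have "4 * real g < 4 * real m - 1" using 3 by linarith
      then show "pi < (4 * real m - 1) * (\<theta> / 2)" using t gt by (metis mult_strict_right_mono)
      have "4 * real m - 1 < 2 * (4 * real g)" using m by linarith
      then show "(4 * real m - 1) * (\<theta> / 2) < 2 * pi"
        using t gt by (metis mult.assoc mult_strict_right_mono)
    qed
    then show ?thesis using 3 orbit_sign[of i m] i x by auto
  qed
qed

text \<open>
  After \<open>g\<close> steps the projection of \<open>\<alpha>\<^sub>i\<close> is reversed, and lies on an edge of the cone of negative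
  roots. Hence the factor of the Coxeter element belonging to \<open>i\<close> negates this root; since the
  factor also conjugates the Coxeter element to its inverse, \<open>g\<close> steps forward and \<open>g\<close> steps back
  lead to the same root.
\<close>

lemma cox_inv_period_base:
  assumes i: "i \<in> I1 \<union> I2"
  shows "(cox_inv ^^ (2 * g)) (base i) = base i"
proof -
  let ?w = "(cox_inv ^^ g) (base i)"
  have wR: "?w \<in> R" by (rule orbit_in_R[OF i])
  have gt: "2 * real g * \<theta> = pi" using g_pos by simp
  have st: "sin \<theta> \<noteq> 0" using \<theta>_bounds sin_gt_zero by (metis less_irrefl)
  \<comment> \<open>After g steps the direction has turned by \<pi>. Rotated back by the phase, its
    height vanishes; at t = 0 this isolates the weight of \<open>I2\<close>, at t = \<theta> that of
    \<open>I1\<close>, each with the factor sin \<theta> \<noteq> 0.\<close>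
  have h: "height (- phase i) ?w = 0"
    unfolding height_orbit[OF i] gt by simp
  have "(\<lambda>j. - ?w j) = (\<lambda>j. - (cox ^^ g) (base i) j)"
  proof (cases "i \<in> I1")
    case True
    then have "weight I2 ?w = 0" using h st by (simp add: height_def phase_def)
    then have "?w j = 0" if "j \<notin> I1" for j
      using that weight_eq_0D[OF wR, of I2 j] R_supported[OF wR, of j] by blast
    then have "(\<lambda>j. - ?w j) = refl I1 ?w" by (rule refl1_supported[symmetric])
    also have "\<dots> = (cox ^^ g) (refl I1 (base i))" by (rule refl1_cox_inv_pow)
    also have "refl I1 (base i) = (\<lambda>j. - base i j)"
      using True by (intro refl1_supported) (auto simp: base_def)
    finally show ?thesis by (simp add: cox_pow_uminus)
  next
    case False
    then have i2: "i \<in> I2" using i by simp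
    have "weight I1 ?w = 0" using h st False by (simp add: height_def phase_def)
    then have "?w j = 0" if "j \<notin> I2" for j
      using that weight_eq_0D[OF wR, of I1 j] R_supported[OF wR, of j] by blast
    then have "(\<lambda>j. - ?w j) = refl I2 ?w" by (rule refl2_supported[symmetric])
    also have "\<dots> = (cox ^^ g) (refl I2 (base i))" by (rule refl2_cox_inv_pow)
    also have "refl I2 (base i) = (\<lambda>j. - base i j)"
      using i2 by (intro refl2_supported) (auto simp: base_def)
    finally show ?thesis by (simp add: cox_pow_uminus)
  qed
  then have "?w = (cox ^^ g) (base i)" by (simp add: fun_eq_iff)
  then show ?thesis by (simp add: mult_2 funpow_add)
qed

lemma cox_inv_period:
  assumes "\<And>j. j \<notin> I1 \<union> I2 \<Longrightarrow> c j = 0"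
  shows "(cox_inv ^^ (2 * g)) c = c"
proof -
  \<comment> \<open>\<open>base i i\<close> is 1 or -1, so multiplying by it twice restores the
    coefficient.\<close>
  have c: "c = (\<lambda>j. \<Sum>i\<in>I1 \<union> I2. (c i * base i i) * base i j)"
  proof
    fix j
    have "(\<Sum>i\<in>I1 \<union> I2. (c i * base i i) * base i j) = (\<Sum>i\<in>I1 \<union> I2. if i = j then c j else 0)"
      by (intro sum.cong) (auto simp: base_def)
    then show "c j = (\<Sum>i\<in>I1 \<union> I2. (c i * base i i) * base i j)"
      using fin assms by auto
  qed
  have "(cox_inv ^^ (2 * g)) (\<lambda>j. \<Sum>i\<in>I1 \<union> I2. (c i * base i i) * base i j)
      = (\<lambda>j. \<Sum>i\<in>I1 \<union> I2. (c i * base i i) * base i j)"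
    unfolding cox_inv_pow_sum by (intro ext sum.cong) (simp_all add: cox_inv_period_base)
  then show ?thesis using c by metis
qed

text \<open>The angle determines the number of steps modulo the period but not the index; undoing
  equally many steps on both sides leaves two base vectors to compare.\<close>

lemma orbit_eq_iff:
  assumes i: "i \<in> I1 \<union> I2" and j: "j \<in> I1 \<union> I2"
  shows "(cox_inv ^^ m) (base i) = (cox_inv ^^ n) (base j) \<longleftrightarrow> i = j \<and> m mod (2 * g) = n mod (2 * g)"
proof -
  have red: "(cox_inv ^^ m) (base i) = (cox_inv ^^ (m mod (2 * g))) (base i)"
    if "i \<in> I1 \<union> I2" for i m
    using funpow_mod_eq[OF cox_inv_period_base[OF that]] by simp
  show ?thesis
  proof safe
    assume eq: "(cox_inv ^^ m) (base i) = (cox_inv ^^ n) (base j)"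
    then show mn: "m mod (2 * g) = n mod (2 * g)" by (rule orbit_eq_imp_mod_eq[OF i j])
    have "(cox ^^ (m mod (2 * g))) ((cox_inv ^^ (m mod (2 * g))) (base i))
        = (cox ^^ (m mod (2 * g))) ((cox_inv ^^ (m mod (2 * g))) (base j))"
      using eq red[OF i, of m] red[OF j, of n] mn by simp
    then have "base i i = base j i" by simp
    then show "i = j" by (auto simp: base_def split: if_splits)
  next
    assume "m mod (2 * g) = n mod (2 * g)" "i = j"
    then show "(cox_inv ^^ m) (base j) = (cox_inv ^^ n) (base j)"
      using red[OF j, of m] red[OF j, of n] by simp
  qed
qed

end

section \<open>Positive eigenvectors of the Cartan matrices\<close>

text \<open>\<open>g\<close> is a candidate for half the Coxeter number, prescribed by the
  eigenvalue: k + 1 for type A of rank 2k + 1, l - 1 for type D, and 6, 9, 15 for the E types. The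
  order of the Coxeter element confirms it in \<open>ord_\<sigma>\<close>.\<close>

definition perron_vector :: "dynkin_series \<Rightarrow> nat \<Rightarrow> nat \<Rightarrow> (nat \<Rightarrow> real) \<Rightarrow> bool" where
  "perron_vector X l g v \<longleftrightarrow> (\<forall>i\<in>{1..l}. 0 < v i \<and>
     (\<Sum>j\<in>{1..l}. cartan_entry X l i j * of_real (v j)) =
       of_real ((2 - 2 * cos (pi / (2 * real g))) * v i))"

text \<open>\<open>N\<close> may contain positions beyond the diagram, provided \<open>v\<close> is
  0 there; the end nodes of a chain can then share the equation of the inner nodes.\<close>

lemma cartan_row_sum:
  assumes i: "i \<in> {1..l}" and "finite N"
    and N: "\<And>j. j \<in> {1..l} \<Longrightarrow> j \<in> N \<longleftrightarrow> j \<noteq> i \<and> (dynkin_edge X l i j \<or> dynkin_edge X l j i)"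
    and v0: "\<And>j. j \<in> N \<Longrightarrow> j \<notin> {1..l} \<Longrightarrow> v j = 0"
    and sum: "(\<Sum>j\<in>N. v j) = c * v i"
  shows "(\<Sum>j\<in>{1..l}. cartan_entry X l i j * of_real (v j)) = of_real ((2 - c) * v i)"
proof -
  have iN: "i \<notin> N" using N[OF i] by simp
  have "(\<Sum>j\<in>{1..l}. cartan_entry X l i j * of_real (v j))
      = (\<Sum>j\<in>{1..l}. of_real ((if j = i then 2 * v i else 0) - (if j \<in> N then v j else 0)))"
    using N iN by (intro sum.cong) (auto simp: cartan_entry_def)
  also have "\<dots> = of_real (2 * v i - (\<Sum>j\<in>{1..l}. if j \<in> N then v j else 0))"
    using i by (simp only: of_real_sum[symmetric] sum_subtractf) (simp add: sum.delta)
  also have "(\<Sum>j\<in>{1..l}. if j \<in> N then v j else 0) = (\<Sum>j\<in>N. v j)"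
  proof -
    have "(\<Sum>j\<in>{1..l}. if j \<in> N then v j else 0) = (\<Sum>j\<in>{1..l} \<inter> N. v j)"
      by (simp add: sum.inter_restrict)
    also have "\<dots> = (\<Sum>j\<in>N. v j)"
      using \<open>finite N\<close> v0 by (intro sum.mono_neutral_left) blast+
    finally show ?thesis .
  qed
  finally show ?thesis by (simp add: sum left_diff_distrib)
qed

lemma sin_recurrence:
  fixes x t :: real
  shows "sin (x - t) + sin (x + t) = 2 * cos t * sin x"
  by (simp add: sin_add sin_diff)

text \<open>The sine recurrence is the eigenvalue equation of a chain; sin vanishes at the two
  missing neighbours 0 and 2g = l + 1.\<close>

lemma perron_vector_A:
  assumes "l = 2 * g - 1" "0 < g" and t_eq: "t = pi / (2 * real g)"
  shows "perron_vector Type_A l g (\<lambda>i. sin (real i * t))"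
  unfolding perron_vector_def t_eq[symmetric]
proof (intro ballI conjI)
  have t: "0 < t" "2 * real g * t = pi" using assms by simp_all
  fix i assume i: "i \<in> {1..l}"
  show "0 < sin (real i * t)"
  proof (rule sin_gt_zero)
    show "0 < real i * t" using i t by (intro mult_pos_pos) auto
    have "real i < 2 * real g" using i assms by auto
    then show "real i * t < pi" using t by (metis mult_strict_right_mono)
  qed
  show "(\<Sum>j\<in>{1..l}. cartan_entry Type_A l i j * of_real (sin (real j * t)))
      = of_real ((2 - 2 * cos t) * sin (real i * t))"
  proof (rule cartan_row_sum[OF i, of "{i - 1, i + 1}"])
    show "sin (real j * t) = 0" if "j \<in> {i - 1, i + 1}" "j \<notin> {1..l}" for j
    proof -
      have "j = 0 \<or> j = 2 * g" using that i assms by auto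
      then show ?thesis using t(2) by auto
    qed
    have "real i * t - t = real (i - 1) * t" "real i * t + t = real (i + 1) * t"
      using i by (auto simp: of_nat_diff left_diff_distrib distrib_right)
    then show "(\<Sum>j\<in>{i - 1, i + 1}. sin (real j * t)) = 2 * cos t * sin (real i * t)"
      using sin_recurrence[of "real i * t" t] i by simp
  qed (use i in auto)
qed

text \<open>A sine wave runs along the chain, doubled, and would reach its crest 2 sin (\<pi>/2) = 2
  at position l - 1. The fork splits this value into 1 + 1.\<close>

lemma perron_vector_D:
  assumes "4 \<le> l" "g = l - 1" and t_eq: "t = pi / (2 * real g)"
  shows "perron_vector Type_D l g (\<lambda>i. if i < l - 1 then 2 * sin (real i * t) else 1)"
  unfolding perron_vector_def t_eq[symmetric]
proof (intro ballI conjI)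
  let ?v = "\<lambda>i. if i < l - 1 then 2 * sin (real i * t) else 1"
  have "0 < g" using assms by simp
  then have t: "0 < t" "2 * real g * t = pi" using t_eq by simp_all
  then have g: "real (l - 1) * t = pi / 2" using assms(2) by simp
  have l: "real (l - 2) * t = pi / 2 - t" "real (l - 3) * t = real (l - 2) * t - t"
    "pi / 2 = real (l - 2) * t + t"
    using assms(1) g by (auto simp: of_nat_diff left_diff_distrib)
  fix i assume i: "i \<in> {1..l}"
  show "0 < ?v i"
  proof (cases "i < l - 1")
    case True
    have "0 < sin (real i * t)"
    proof (rule sin_gt_zero)
      show "0 < real i * t" using i t by (intro mult_pos_pos) auto
      have "real i < 2 * real g" using True assms by auto
      then show "real i * t < pi" using t by (metis mult_strict_right_mono)
    qed
    then show ?thesis by simp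
  qed simp
  consider "i < l - 2" | "i = l - 2" | "i = l - 1" | "i = l" using i by fastforce
  then show "(\<Sum>j\<in>{1..l}. cartan_entry Type_D l i j * of_real (?v j))
      = of_real ((2 - 2 * cos t) * ?v i)"
  proof cases
    case 1
    show ?thesis
    proof (rule cartan_row_sum[OF i, of "{i - 1, i + 1}"])
      have "real i * t - t = real (i - 1) * t" "real i * t + t = real (i + 1) * t"
        using i by (auto simp: of_nat_diff left_diff_distrib distrib_right)
      moreover have "i - 1 < l - 1" "i + 1 < l - 1" "i < l - 1" "i - 1 \<noteq> i + 1" using 1 by auto
      ultimately show "(\<Sum>j\<in>{i - 1, i + 1}. ?v j) = 2 * cos t * ?v i"
        using sin_recurrence[of "real i * t" t] by simp
    qed (use i 1 assms(1) in auto)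
  next
    case 2
    show ?thesis
    proof (rule cartan_row_sum[OF i, of "{l - 3, l - 1, l}"])
      have lt: "l - 3 < l - 1" "l - 2 < l - 1" using assms(1) by auto
      have "?v (l - 3) = 2 * sin (real (l - 2) * t - t)" by (simp only: lt if_True l(2))
      \<comment> \<open>The two fork ends together stand for the single crest value of the
        wave.\<close>
      moreover have "?v (l - 1) + ?v l = 2 * sin (real (l - 2) * t + t)"
      proof -
        have "sin (real (l - 2) * t + t) = 1" using l(3) by (metis sin_pi_half)
        moreover have "\<not> l < l - 1" by simp
        ultimately show ?thesis by simp
      qed
      moreover have "?v i = 2 * sin (real (l - 2) * t)" by (simp only: 2 lt if_True)
      moreover have "(\<Sum>j\<in>{l - 3, l - 1, l}. ?v j) = ?v (l - 3) + (?v (l - 1) + ?v l)"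
      proof -
        have "l - 3 \<noteq> l - 1" "l - 3 \<noteq> l" "l - 1 \<noteq> l" using assms(1) by auto
        then show ?thesis by simp
      qed
      ultimately show "(\<Sum>j\<in>{l - 3, l - 1, l}. ?v j) = 2 * cos t * ?v i"
        using sin_recurrence[of "real (l - 2) * t" t] by simp
    qed (use i 2 assms(1) in auto)
  next
    case 3
    show ?thesis
    proof (rule cartan_row_sum[OF i, of "{l - 2}"])
      have "sin (real (l - 2) * t) = cos t" unfolding l(1) by (simp add: sin_diff)
      moreover have "l - 2 < l - 1" "\<not> i < l - 1" using 3 assms(1) by auto
      ultimately show "(\<Sum>j\<in>{l - 2}. ?v j) = 2 * cos t * ?v i" by simp
    qed (use i 3 assms(1) in auto)
  next
    case 4
    show ?thesis
    proof (rule cartan_row_sum[OF i, of "{l - 2}"])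
      have "sin (real (l - 2) * t) = cos t" unfolding l(1) by (simp add: sin_diff)
      moreover have "l - 2 < l - 1" "\<not> i < l - 1" using 4 assms(1) by auto
      ultimately show "(\<Sum>j\<in>{l - 2}. ?v j) = 2 * cos t * ?v i" by simp
    qed (use i 4 assms(1) in auto)
  qed
qed

text \<open>On each arm of the diagram, counted from its free end, the entries are proportional to
  \<open>sin (k t)\<close>, scaled so that the branch node gets the entry \<open>1\<close>.\<close>

lemma perron_vector_E:
  assumes l: "6 \<le> l" "l \<le> 8" and "l \<le> 2 * g" "1 < g"
    and branch: "sin t / sin (2 * t) + sin (2 * t) / sin (3 * t) + sin (real (l - 4) * t) / sin (real (l - 3) * t)
      = 2 * cos t" and t_eq: "t = pi / (2 * real g)"
  shows "perron_vector Type_E l g (\<lambda>i. if i = 1 then sin t / sin (3 * t) else if i = 2 then sin t / sin (2 * t)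
    else if i = 3 then sin (2 * t) / sin (3 * t) else sin (real (l + 1 - i) * t) / sin (real (l - 3) * t))"
  unfolding perron_vector_def t_eq[symmetric]
proof (intro ballI conjI)
  let ?v = "\<lambda>i. if i = 1 then sin t / sin (3 * t) else if i = 2 then sin t / sin (2 * t)
    else if i = 3 then sin (2 * t) / sin (3 * t) else sin (real (l + 1 - i) * t) / sin (real (l - 3) * t)"
  have t: "0 < t" "2 * real g * t = pi" using \<open>1 < g\<close> by (simp_all add: t_eq)
  have pos: "0 < sin (real k * t)" if "1 \<le> k" "k < l" for k
  proof (rule sin_gt_zero)
    show "0 < real k * t" using that t by (intro mult_pos_pos) auto
    have "real k < 2 * real g" using that \<open>l \<le> 2 * g\<close> by linarith
    then show "real k * t < pi" using t by (metis mult_strict_right_mono)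
  qed
  have pos': "0 < sin t" "0 < sin (2 * t)" "0 < sin (3 * t)" "0 < sin (real (l - 3) * t)"
    using pos[of 1] pos[of 2] pos[of 3] pos[of "l - 3"] l by simp_all
  have s2: "sin (2 * t) = 2 * cos t * sin t" by (simp add: sin_double)
  have s3: "sin t + sin (3 * t) = 2 * cos t * sin (2 * t)"
    using sin_recurrence[of "2 * t" t] by simp
  fix i assume i: "i \<in> {1..l}"
  show "0 < ?v i"
    using i l pos' pos[of "l + 1 - i"] by (auto intro!: divide_pos_pos)
  consider "i = 1" | "i = 2" | "i = 3" | "i = 4" | "5 \<le> i" using i by fastforce
  then show "(\<Sum>j\<in>{1..l}. cartan_entry Type_E l i j * of_real (?v j)) = of_real ((2 - 2 * cos t) * ?v i)"
  proof cases
    case 1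
    show ?thesis
      by (rule cartan_row_sum[OF i, of "{3}"]) (use 1 l s2 in auto)
  next
    case 2
    show ?thesis
      by (rule cartan_row_sum[OF i, of "{4}"]) (use 2 l s2 pos' in auto)
  next
    case 3
    show ?thesis
      by (rule cartan_row_sum[OF i, of "{1, 4}"]) (use 3 l s3 pos' in \<open>auto simp: field_simps\<close>)
  next
    case 4
    \<comment> \<open>Node 4 carries the branch: its neighbours lie on three arms, and its row is
      exactly the hypothesis \<open>branch\<close>.\<close>
    have "?v 5 = sin (real (l - 4) * t) / sin (real (l - 3) * t)" by (simp add: numeral_eq_Suc)
    then show ?thesis
      using 4 l branch pos' by (intro cartan_row_sum[OF i, of "{2, 3, 5}"]) auto
  next
    case 5
    have e: "real (l + 1 - (i - 1)) * t = real (l + 1 - i) * t + t"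
      "real (l + 1 - (i + 1)) * t = real (l + 1 - i) * t - t"
      using i 5 by (auto simp: of_nat_diff algebra_simps)
    have v: "?v j = sin (real (l + 1 - j) * t) / sin (real (l - 3) * t)" if "4 \<le> j" for j
      using that by auto
    have i4: "4 \<le> i - 1" "4 \<le> i + 1" "4 \<le> i" using 5 by auto
    have "?v (i - 1) + ?v (i + 1)
        = (sin (real (l + 1 - i) * t - t) + sin (real (l + 1 - i) * t + t)) / sin (real (l - 3) * t)"
      unfolding v[OF i4(1)] v[OF i4(2)] unfolding e by (simp only: add_divide_distrib add.commute)
    also have "\<dots> = 2 * cos t * ?v i" by (simp only: sin_recurrence v[OF i4(3)] times_divide_eq_right)
    finally have v_sum: "?v (i - 1) + ?v (i + 1) = 2 * cos t * ?v i" .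
    have pair: "(\<Sum>j\<in>{i - 1, i + 1}. w j) = w (i - 1) + w (i + 1)" for w :: "nat \<Rightarrow> real"
      by simp
    show ?thesis
    proof (rule cartan_row_sum[OF i, of "{i - 1, i + 1}"])
      show "j \<in> {i - 1, i + 1} \<longleftrightarrow> j \<noteq> i \<and> (dynkin_edge Type_E l i j \<or> dynkin_edge Type_E l j i)" for j
        using 5 by auto
      \<comment> \<open>The only position beyond the diagram is l + 1, where the argument of sin is
        0.\<close>
      show "?v j = 0" if "j \<in> {i - 1, i + 1}" "j \<notin> {1..l}" for j
      proof -
        have "j = l + 1" using that i 5 by auto
        then show ?thesis using l by simp
      qed
    qed (use v_sum in \<open>simp_all only: pair finite.intros\<close>)
  qed
qed

section \<open>Eigenvectors for the exceptional types, by polynomial identities in 2 cos t\<close>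

lemma sin_multiples:
  fixes t :: real
  assumes c: "2 * cos t = c"
  shows "sin (2 * t) = c * sin t" "sin (3 * t) = (c\<^sup>2 - 1) * sin t"
    "sin (4 * t) = c * (c\<^sup>2 - 2) * sin t" "sin (5 * t) = (c ^ 4 - 3 * c\<^sup>2 + 1) * sin t"
proof -
  show 2: "sin (2 * t) = c * sin t" using sin_double[of t] c by simp
  \<comment> \<open>The recursion of the Chebyshev polynomials of the second kind, which express sin
    (k t) / sin t through c.\<close>
  have r: "sin (x - t) + sin (x + t) = c * sin x" for x
    unfolding sin_recurrence c ..
  have "sin t + sin (3 * t) = c * (c * sin t)" using r[of "2 * t"] 2 by simp
  then show 3: "sin (3 * t) = (c\<^sup>2 - 1) * sin t" by (simp add: algebra_simps power2_eq_square)
  have "c * sin t + sin (4 * t) = c * ((c\<^sup>2 - 1) * sin t)" using r[of "3 * t"] 2 3 by simp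
  then show 4: "sin (4 * t) = c * (c\<^sup>2 - 2) * sin t" by (simp add: algebra_simps)
  have "(c\<^sup>2 - 1) * sin t + sin (5 * t) = c * (c * (c\<^sup>2 - 2) * sin t)"
    using r[of "4 * t"] 3 4 by simp
  then show "sin (5 * t) = (c ^ 4 - 3 * c\<^sup>2 + 1) * sin t"
    by (simp add: algebra_simps power2_eq_square power4_eq_xxxx)
qed

lemma cos_double_root: "(2 * cos t)\<^sup>2 = 2 + 2 * cos (2 * t)" for t :: real
  by (simp add: cos_double_cos power_mult_distrib)

text \<open>Cleared of denominators, the branch condition is c^4 - 4 c^2 + 1 = 0, that is (c^2 -
  2)^2 = 3; and c^2 - 2 = 2 cos (\<pi>/6) is the square root of 3.\<close>

lemma perron_vector_E6: "\<exists>v. perron_vector Type_E 6 6 v"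
proof -
  define t where "t = pi / 12"
  define c where "c = 2 * cos t"
  have "cos (2 * t) = sqrt 3 / 2" by (simp add: t_def cos_30)
  then have "c\<^sup>2 - 2 = sqrt 3" using cos_double_root[of t] by (simp add: c_def)
  then have "(c\<^sup>2 - 2)\<^sup>2 = 3" by simp
  moreover have "c ^ 4 - 4 * c\<^sup>2 + 1 = (c\<^sup>2 - 2)\<^sup>2 - 3"
    by (simp add: power2_eq_square power4_eq_xxxx algebra_simps)
  ultimately have poly: "c ^ 4 - 4 * c\<^sup>2 + 1 = 0" by simp
  have "0 < sin (k * t)" if "0 < k" "k < 12" for k
    using that by (intro sin_gt_zero) (auto simp: t_def)
  from this[of 1] this[of 2] this[of 3] have "0 < sin t" "0 < c * sin t" "0 < (c\<^sup>2 - 1) * sin t"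
    by (simp_all add: sin_multiples[OF c_def[symmetric]])
  then have pos: "0 < sin t" "0 < c" "0 < c\<^sup>2 - 1" by (simp_all add: zero_less_mult_iff)
  have "1 / c + c / (c\<^sup>2 - 1) + c / (c\<^sup>2 - 1) - c = - (c ^ 4 - 4 * c\<^sup>2 + 1) / (c * (c\<^sup>2 - 1))"
    using pos by (simp add: divide_simps) (simp add: algebra_simps eval_nat_numeral)
  then have "1 / c + c / (c\<^sup>2 - 1) + c / (c\<^sup>2 - 1) = c" using poly by simp
  then have "sin t / sin (2 * t) + sin (2 * t) / sin (3 * t) + sin (2 * t) / sin (3 * t) = c"
    using pos by (simp add: sin_multiples[OF c_def[symmetric]])
  then have branch: "sin t / sin (2 * t) + sin (2 * t) / sin (3 * t)
      + sin (real (6 - 4) * t) / sin (real (6 - 3) * t) = 2 * cos t" by (simp add: c_def)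
  show ?thesis
    by (rule exI, rule perron_vector_E[OF _ _ _ _ branch, of 6]) (simp_all add: t_def)
qed

text \<open>The triple-angle formula at 2t = \<pi>/9, where cos (6t) = 1/2, is a cubic for c^2 - 2.
  Written in c it is the sextic left after clearing denominators in the branch condition.\<close>

lemma perron_vector_E7: "\<exists>v. perron_vector Type_E 7 9 v"
proof -
  define t where "t = pi / 18"
  define c where "c = 2 * cos t"
  have "cos (3 * (2 * t)) = 1 / 2" by (simp add: t_def cos_60)
  then have "4 * cos (2 * t) ^ 3 - 3 * cos (2 * t) = 1 / 2" by (simp only: cos_treble_cos)
  then have "8 * cos (2 * t) ^ 3 - 6 * cos (2 * t) - 1 = 0" by simp
  moreover have "c\<^sup>2 = 2 + 2 * cos (2 * t)" using cos_double_root[of t] by (simp add: c_def)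
  ultimately have poly: "c ^ 6 - 6 * c ^ 4 + 9 * c\<^sup>2 - 3 = 0" by Groebner_Basis.algebra
  have "0 < sin (k * t)" if "0 < k" "k < 18" for k
    using that by (intro sin_gt_zero) (auto simp: t_def)
  from this[of 1] this[of 2] this[of 3] this[of 4]
  have "0 < sin t" "0 < c * sin t" "0 < (c\<^sup>2 - 1) * sin t" "0 < c * (c\<^sup>2 - 2) * sin t"
    by (simp_all add: sin_multiples[OF c_def[symmetric]])
  then have pos: "0 < sin t" "0 < c" "0 < c\<^sup>2 - 1" "0 < c\<^sup>2 - 2" by (simp_all add: zero_less_mult_iff)
  have "1 / c + c / (c\<^sup>2 - 1) + (c\<^sup>2 - 1) / (c * (c\<^sup>2 - 2)) - c = - (c ^ 6 - 6 * c ^ 4 + 9 * c\<^sup>2 - 3) / (c * (c\<^sup>2 - 1) * (c\<^sup>2 - 2))"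
    using pos by (simp add: divide_simps) (simp add: algebra_simps eval_nat_numeral)
  then have "1 / c + c / (c\<^sup>2 - 1) + (c\<^sup>2 - 1) / (c * (c\<^sup>2 - 2)) = c" using poly by simp
  then have "sin t / sin (2 * t) + sin (2 * t) / sin (3 * t) + sin (3 * t) / sin (4 * t) = c"
    using pos by (simp add: sin_multiples[OF c_def[symmetric]])
  then have branch: "sin t / sin (2 * t) + sin (2 * t) / sin (3 * t)
      + sin (real (7 - 4) * t) / sin (real (7 - 3) * t) = 2 * cos t" by (simp add: c_def)
  show ?thesis
    by (rule exI, rule perron_vector_E[OF _ _ _ _ branch, of 9]) (simp_all add: t_def)
qed

text \<open>For y = 2 cos (2t) with 2t = \<pi>/15, the value 2 cos (10t) = 1 is a quintic equation
  in y. Apart from the factor y - 1 it is a quartic, which in c is the cleared branch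
  condition.\<close>

lemma perron_vector_E8: "\<exists>v. perron_vector Type_E 8 15 v"
proof -
  define t where "t = pi / 30"
  define c where "c = 2 * cos t"
  define y where "y = 2 * cos (2 * t)"
  have y: "y = c\<^sup>2 - 2" using cos_double_root[of t] by (simp add: y_def c_def)
  have rec: "2 * cos (x + 2 * t) = y * (2 * cos x) - 2 * cos (x - 2 * t)" for x
    by (simp add: y_def cos_add cos_diff)
  have y2: "2 * cos (4 * t) = y\<^sup>2 - 2"
    using rec[of "2 * t"] by (simp add: power2_eq_square flip: y_def)
  have y3: "2 * cos (6 * t) = y ^ 3 - 3 * y"
  proof -
    have "2 * cos (6 * t) = y * (2 * cos (4 * t)) - y" using rec[of "4 * t"] by (simp add: y_def)
    then show ?thesis unfolding y2 by (simp add: algebra_simps power2_eq_square power3_eq_cube)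
  qed
  have y4: "2 * cos (8 * t) = y ^ 4 - 4 * y\<^sup>2 + 2"
  proof -
    have "2 * cos (8 * t) = y * (2 * cos (6 * t)) - 2 * cos (4 * t)" using rec[of "6 * t"] by simp
    then show ?thesis
      unfolding y2 y3 by (simp add: algebra_simps power2_eq_square power3_eq_cube power4_eq_xxxx)
  qed
  have y5: "2 * cos (10 * t) = y * (y ^ 4 - 4 * y\<^sup>2 + 2) - (y ^ 3 - 3 * y)"
  proof -
    have "2 * cos (10 * t) = y * (2 * cos (8 * t)) - 2 * cos (6 * t)" using rec[of "8 * t"] by simp
    then show ?thesis unfolding y3 y4 .
  qed
  have "2 * cos (10 * t) = 1" by (simp add: t_def cos_60)
  moreover have "(y - 1) * (y ^ 4 + y ^ 3 - 4 * y\<^sup>2 - 4 * y + 1)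
      = y * (y ^ 4 - 4 * y\<^sup>2 + 2) - (y ^ 3 - 3 * y) - 1"
    by (simp add: algebra_simps eval_nat_numeral)
  ultimately have "(y - 1) * (y ^ 4 + y ^ 3 - 4 * y\<^sup>2 - 4 * y + 1) = 0" using y5 by simp
  \<comment> \<open>The discarded root y = 1 belongs to the angle \<pi>/3, whereas 2t is
    smaller.\<close>
  moreover have "cos (pi / 3) < cos (2 * t)" by (intro cos_monotone_0_pi) (auto simp: t_def)
  then have "1 < y" by (simp add: y_def cos_60)
  ultimately have "y ^ 4 + y ^ 3 - 4 * y\<^sup>2 - 4 * y + 1 = 0" by simp
  moreover have "c ^ 8 - 7 * c ^ 6 + 14 * c ^ 4 - 8 * c\<^sup>2 + 1 = y ^ 4 + y ^ 3 - 4 * y\<^sup>2 - 4 * y + 1"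
    unfolding y by (simp add: algebra_simps eval_nat_numeral)
  ultimately have poly: "c ^ 8 - 7 * c ^ 6 + 14 * c ^ 4 - 8 * c\<^sup>2 + 1 = 0" by simp
  have "0 < sin (k * t)" if "0 < k" "k < 30" for k
    using that by (intro sin_gt_zero) (auto simp: t_def)
  from this[of 1] this[of 2] this[of 3] this[of 4] this[of 5]
  have "0 < sin t" "0 < c * sin t" "0 < (c\<^sup>2 - 1) * sin t" "0 < c * (c\<^sup>2 - 2) * sin t"
    "0 < (c ^ 4 - 3 * c\<^sup>2 + 1) * sin t"
    by (simp_all add: sin_multiples[OF c_def[symmetric]])
  then have pos: "0 < sin t" "0 < c" "0 < c\<^sup>2 - 1" "0 < c\<^sup>2 - 2" "0 < c ^ 4 - 3 * c\<^sup>2 + 1"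
    by (simp_all add: zero_less_mult_iff)
  have "1 / c + c / (c\<^sup>2 - 1) + c * (c\<^sup>2 - 2) / (c ^ 4 - 3 * c\<^sup>2 + 1) - c = - (c ^ 8 - 7 * c ^ 6 + 14 * c ^ 4 - 8 * c\<^sup>2 + 1) / (c * (c\<^sup>2 - 1) * (c ^ 4 - 3 * c\<^sup>2 + 1))"
  proof -
    have frac: "1 / c + c / d + n / w - c = (d * w + c * c * w + n * c * d - c * c * d * w) / (c * d * w)"
      if "0 < d" "0 < w" for d n w
      using that pos by (simp add: field_simps)
    have num: "(c\<^sup>2 - 1) * (c ^ 4 - 3 * c\<^sup>2 + 1) + c * c * (c ^ 4 - 3 * c\<^sup>2 + 1)
        + c * (c\<^sup>2 - 2) * c * (c\<^sup>2 - 1) - c * c * (c\<^sup>2 - 1) * (c ^ 4 - 3 * c\<^sup>2 + 1)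
        = - (c ^ 8 - 7 * c ^ 6 + 14 * c ^ 4 - 8 * c\<^sup>2 + 1)"
      by (simp add: algebra_simps eval_nat_numeral)
    show ?thesis unfolding frac[OF pos(3) pos(5)] num ..
  qed
  then have "1 / c + c / (c\<^sup>2 - 1) + c * (c\<^sup>2 - 2) / (c ^ 4 - 3 * c\<^sup>2 + 1) = c" using poly by simp
  then have "sin t / sin (2 * t) + sin (2 * t) / sin (3 * t) + sin (4 * t) / sin (5 * t) = c"
    using pos by (simp add: sin_multiples[OF c_def[symmetric]])
  then have branch: "sin t / sin (2 * t) + sin (2 * t) / sin (3 * t)
      + sin (real (8 - 4) * t) / sin (real (8 - 3) * t) = 2 * cos t" by (simp add: c_def)
  show ?thesis
    by (rule exI, rule perron_vector_E[OF _ _ _ _ branch, of 15]) (simp_all add: t_def)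
qed

lemma perron_vector_exists:
  assumes "X = Type_A \<and> odd l \<or> X = Type_D \<and> 4 \<le> l \<or> X = Type_E \<and> l \<in> {6, 7, 8}"
  shows "\<exists>g v. 0 < g \<and> perron_vector X l g v"
proof -
  consider k where "X = Type_A" "l = 2 * k + 1" | "X = Type_D" "4 \<le> l" |
    "X = Type_E" "l = 6" | "X = Type_E" "l = 7" | "X = Type_E" "l = 8"
    using assms by (auto elim: oddE)
  then show ?thesis
  proof cases
    case (1 k)
    then show ?thesis using perron_vector_A[of l "k + 1"] by auto
  next
    case 2
    then have "\<exists>v. perron_vector X l (l - 1) v" using perron_vector_D[OF 2(2) refl refl] by blast
    moreover have "0 < l - 1" using 2 by simp
    ultimately show ?thesis by blast
  next
    case 3
    then show ?thesis using perron_vector_E6 by (intro exI[of _ 6]) simp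
  next
    case 4
    then show ?thesis using perron_vector_E7 by (intro exI[of _ 9]) simp
  next
    case 5
    then show ?thesis using perron_vector_E8 by (intro exI[of _ 15]) simp
  qed
qed

section \<open>Orbits of the Coxeter element\<close>

locale bipartite_root_system =
  cartan_decomposition scale Basis br H + bipartite_cartan_matrix I1 I2 C v g
  for scale :: "complex \<Rightarrow> 'g::ab_group_add \<Rightarrow> 'g" and Basis :: "'g set" and br and H
    and I1 I2 :: "nat set" and C :: "nat \<Rightarrow> nat \<Rightarrow> complex" and v :: "nat \<Rightarrow> real" and g :: nat +
  fixes \<alpha> :: "nat \<Rightarrow> 'g \<Rightarrow> complex"
  assumes rank: "card (I1 \<union> I2) = dim H" and nonempty: "I1 \<union> I2 \<noteq> {}"
    and simple_roots: "simple_roots \<Delta> \<alpha> (I1 \<union> I2)"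
    and cartan_matrix: "\<And>i j. i \<in> I1 \<union> I2 \<Longrightarrow> j \<in> I1 \<union> I2 \<Longrightarrow>
      2 * B (\<alpha> i) (\<alpha> j) / B (\<alpha> j) (\<alpha> j) = C i j"
    and C_Ints: "\<And>i j. C i j \<in> \<int>"
begin

abbreviation I where "I \<equiv> I1 \<union> I2"

text \<open>Coordinates are functions on all natural numbers; setting them to 0 off the index set
  makes \<open>emb\<close> injective.\<close>

definition supported :: "(nat \<Rightarrow> complex) \<Rightarrow> bool" where
  "supported c \<longleftrightarrow> (\<forall>i. i \<notin> I \<longrightarrow> c i = 0)"

definition emb :: "(nat \<Rightarrow> complex) \<Rightarrow> 'g \<Rightarrow> complex" where
  "emb c = (\<lambda>x. \<Sum>i\<in>I. c i * \<alpha> i x)"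

lemma finI: "finite I" using fin by simp

lemma \<alpha>_root: "i \<in> I \<Longrightarrow> \<alpha> i \<in> \<Delta>"
  using simple_roots by (auto simp: simple_roots_def)

lemma \<alpha>_independent:
  assumes "\<And>x. (\<Sum>i\<in>I. c i * \<alpha> i x) = 0"
  shows "\<forall>i\<in>I. c i = 0"
proof -
  have "\<forall>c. (\<forall>x. (\<Sum>i\<in>I. c i * \<alpha> i x) = 0) \<longrightarrow> (\<forall>i\<in>I. c i = 0)"
    using simple_roots unfolding simple_roots_def by (elim conjE)
  from spec[OF this, of c] show ?thesis using assms by simp
qed

lemma \<alpha>_in_V: "i \<in> I \<Longrightarrow> \<alpha> i \<in> V"
  by (simp add: \<alpha>_root root_in_dual)

text \<open>A quotient with denominator 0 is 0 in HOL, which the diagonal Cartan entry 2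
  excludes.\<close>

lemma \<alpha>_nonisotropic: "i \<in> I \<Longrightarrow> B (\<alpha> i) (\<alpha> i) \<noteq> 0"
  using cartan_matrix[of i i] diag[of i] by auto

lemma emb_in_V: "emb c \<in> V"
  unfolding emb_def by (rule dual_space_sum) (rule \<alpha>_in_V)

lemma emb_eqD: "emb c = emb d \<Longrightarrow> i \<in> I \<Longrightarrow> c i = d i"
proof -
  assume eq: "emb c = emb d" and i: "i \<in> I"
  have "(\<Sum>i\<in>I. (c i - d i) * \<alpha> i x) = 0" for x
    using fun_cong[OF eq, of x] by (simp only: emb_def left_diff_distrib sum_subtractf) simp
  then have "\<forall>i\<in>I. c i - d i = 0" by (rule \<alpha>_independent)
  then show "c i = d i" using i by simp
qed

lemma emb_inj: "supported c \<Longrightarrow> supported d \<Longrightarrow> emb c = emb d \<longleftrightarrow> c = d"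
  unfolding supported_def using emb_eqD[of c d] by (metis ext)

lemma V_emb:
  assumes "f \<in> V"
  obtains c where "supported c" "f = emb c"
proof -
  have "\<exists>c. f = (\<lambda>x. \<Sum>i\<in>I. c i * \<alpha> i x)"
    by (rule dual_space_basis[OF finI rank _ _ assms]) (fact \<alpha>_in_V, fact \<alpha>_independent)
  then obtain c where c: "f = (\<lambda>x. \<Sum>i\<in>I. c i * \<alpha> i x)" by (elim exE)
  show ?thesis
    by (rule that[of "\<lambda>i. if i \<in> I then c i else 0"]) (simp_all add: supported_def c emb_def)
qed

lemma supported_refl: "J \<subseteq> I \<Longrightarrow> supported c \<Longrightarrow> supported (refl J c)"
  by (auto simp: supported_def refl_def)

lemma dual_form_emb:
  assumes "i \<in> I"
  shows "2 * B (emb c) (\<alpha> i) / B (\<alpha> i) (\<alpha> i) = (\<Sum>k\<in>I. c k * C k i)"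
proof -
  have "B (emb c) (\<alpha> i) = (\<Sum>k\<in>I. c k * B (\<alpha> k) (\<alpha> i))"
    unfolding emb_def by (rule dual_form_sum_left) (use assms in \<open>simp_all only: \<alpha>_in_V\<close>)
  then have "2 * B (emb c) (\<alpha> i) / B (\<alpha> i) (\<alpha> i) = (\<Sum>k\<in>I. c k * (2 * B (\<alpha> k) (\<alpha> i) / B (\<alpha> i) (\<alpha> i)))"
    by (simp add: sum_distrib_left sum_divide_distrib mult_ac)
  also have "\<dots> = (\<Sum>k\<in>I. c k * C k i)" by (intro sum.cong refl) (simp only: cartan_matrix assms)
  finally show ?thesis .
qed

lemma emb_refl_single:
  assumes "i \<in> I"
  shows "emb (refl {i} c) = (\<lambda>x. emb c x - (\<Sum>k\<in>I. c k * C k i) * \<alpha> i x)"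
proof
  fix x
  have "emb (refl {i} c) x
      = (\<Sum>j\<in>I. c j * \<alpha> j x - (if j = i then (\<Sum>k\<in>I. c k * C k i) * \<alpha> i x else 0))"
    unfolding emb_def by (intro sum.cong) (auto simp: refl_def left_diff_distrib)
  then show "emb (refl {i} c) x = emb c x - (\<Sum>k\<in>I. c k * C k i) * \<alpha> i x"
    using assms finI by (simp add: sum_subtractf emb_def)
qed

lemma reflection_emb: "i \<in> I \<Longrightarrow> reflection V B (\<alpha> i) (emb c) = emb (refl {i} c)"
  by (simp only: reflection_def restrict_apply'[OF emb_in_V] dual_form_emb emb_refl_single)

lemma reflection_Bij:
  assumes "i \<in> I"
  shows "reflection V B (\<alpha> i) \<in> Bij V"
proof -
  let ?s = "reflection V B (\<alpha> i)"
  have "?s f \<in> V \<and> ?s (?s f) = f" if f: "f \<in> V" for f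
  proof -
    obtain c where "f = emb c" using V_emb[OF f] by metis
    then show ?thesis using assms by (simp add: reflection_emb emb_in_V)
  qed
  then have "bij_betw ?s V V" by (intro bij_betw_byWitness[where f' = ?s]) auto
  then show ?thesis by (simp add: Bij_def reflection_def)
qed

lemma BijGroup_mult_apply:
  "x \<in> Bij V \<Longrightarrow> y \<in> Bij V \<Longrightarrow> f \<in> V \<Longrightarrow> (x \<otimes>\<^bsub>BijGroup V\<^esub> y) f = x (y f)"
  by (simp add: BijGroup_def compose_def)

lemma BijGroup_mult_closed: "x \<in> Bij V \<Longrightarrow> y \<in> Bij V \<Longrightarrow> x \<otimes>\<^bsub>BijGroup V\<^esub> y \<in> Bij V"
  by (simp add: BijGroup_def compose_Bij)

text \<open>The induction runs over arbitrary lists of distinct indices from \<open>J\<close>; the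
  sorted list is one of them.\<close>

lemma reflection_prod_emb:
  assumes "J \<subseteq> I" and orth: "\<And>i j. i \<in> J \<Longrightarrow> j \<in> J \<Longrightarrow> i \<noteq> j \<Longrightarrow> C i j = 0"
  shows "reflection_prod V B \<alpha> J \<in> Bij V \<and> reflection_prod V B \<alpha> J (emb c) = emb (refl J c)"
proof -
  have "foldr (\<lambda>i w. reflection V B (\<alpha> i) \<otimes>\<^bsub>BijGroup V\<^esub> w) xs \<one>\<^bsub>BijGroup V\<^esub> \<in> Bij V \<and>
      foldr (\<lambda>i w. reflection V B (\<alpha> i) \<otimes>\<^bsub>BijGroup V\<^esub> w) xs \<one>\<^bsub>BijGroup V\<^esub> (emb c)
        = emb (refl (set xs) c)"
    if "distinct xs" "set xs \<subseteq> J" for xs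
    using that
  proof (induction xs)
    case Nil
    then show ?case using id_Bij[of V] by (simp add: BijGroup_def emb_in_V restrict_def)
  next
    case (Cons i xs)
    have iI: "i \<in> I" using Cons.prems assms(1) by auto
    have "refl (set (i # xs)) c = refl {i} (refl (set xs) c)"
      using Cons.prems orth refl_insert[of i "set xs" c] by auto
    then show ?case
      using Cons reflection_Bij[OF iI]
      by (simp add: BijGroup_mult_apply BijGroup_mult_closed emb_in_V reflection_emb[OF iI])
  qed
  moreover have "finite J" using assms(1) finI finite_subset by blast
  ultimately show ?thesis
    unfolding reflection_prod_def by (metis distinct_sorted_list_of_set set_sorted_list_of_set order_refl)
qed

abbreviation \<sigma> where "\<sigma> \<equiv> coxeter_element V B \<alpha> I1 I2"

lemma \<sigma>_Bij: "\<sigma> \<in> Bij V" and \<sigma>_emb: "\<sigma> (emb c) = emb (cox c)"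
proof -
  have 1: "reflection_prod V B \<alpha> I1 \<in> Bij V \<and> reflection_prod V B \<alpha> I1 (emb c) = emb (refl I1 c)" for c
    using orth1 by (intro reflection_prod_emb) auto
  have 2: "reflection_prod V B \<alpha> I2 \<in> Bij V \<and> reflection_prod V B \<alpha> I2 (emb c) = emb (refl I2 c)" for c
    using orth2 by (intro reflection_prod_emb) auto
  show "\<sigma> \<in> Bij V" "\<sigma> (emb c) = emb (cox c)"
    unfolding coxeter_element_def using 1 2
    by (simp_all add: BijGroup_mult_closed BijGroup_mult_apply emb_in_V cox_def)
qed

interpretation W: group "BijGroup V" by (rule group_BijGroup)

lemma carrier_W: "carrier (BijGroup V) = Bij V"
  by (simp add: BijGroup_def)

lemma \<sigma>_pow_emb: "(\<sigma> [^]\<^bsub>BijGroup V\<^esub> (n :: nat)) (emb c) = emb ((cox ^^ n) c)"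
proof (induction n arbitrary: c)
  case 0
  then show ?case by (simp add: BijGroup_def emb_in_V)
next
  case (Suc n)
  have "\<sigma> [^]\<^bsub>BijGroup V\<^esub> n \<in> Bij V" using W.nat_pow_closed[of \<sigma> n] \<sigma>_Bij by (simp add: carrier_W)
  then show ?case using Suc by (simp add: BijGroup_mult_apply \<sigma>_Bij emb_in_V \<sigma>_emb funpow_swap1)
qed

definition R :: "(nat \<Rightarrow> complex) set" where
  "R = {c. supported c \<and> emb c \<in> \<Delta>}"

lemma nonneg_combs_emb_iff: "emb c \<in> nonneg_combs \<alpha> I \<longleftrightarrow> (\<forall>i\<in>I. c i \<in> \<nat>)"
proof
  assume "emb c \<in> nonneg_combs \<alpha> I"
  then obtain k :: "nat \<Rightarrow> nat" where "emb c = emb (\<lambda>i. of_nat (k i))"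
    unfolding nonneg_combs_def emb_def by auto
  then show "\<forall>i\<in>I. c i \<in> \<nat>" using emb_eqD by fastforce
next
  assume "\<forall>i\<in>I. c i \<in> \<nat>"
  then have "\<forall>i\<in>I. \<exists>k. c i = of_nat k" by (auto elim!: Nats_cases)
  then obtain k where k: "\<forall>i\<in>I. c i = of_nat (k i)" by metis
  then have "emb c = (\<lambda>x. \<Sum>i\<in>I. of_nat (k i) * \<alpha> i x)" unfolding emb_def by simp
  then show "emb c \<in> nonneg_combs \<alpha> I" unfolding nonneg_combs_def by blast
qed

lemma root_coordinates_sign: "c \<in> R \<Longrightarrow> (\<forall>i\<in>I. c i \<in> \<nat>) \<or> (\<forall>i\<in>I. - c i \<in> \<nat>)"
proof -
  assume "c \<in> R"
  then have "emb c \<in> nonneg_combs \<alpha> I \<or> (\<lambda>x. - emb c x) \<in> nonneg_combs \<alpha> I"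
    using simple_roots by (simp add: R_def simple_roots_def)
  moreover have "(\<lambda>x. - emb c x) = emb (\<lambda>i. - c i)" by (simp add: emb_def sum_negf)
  ultimately show ?thesis by (simp add: nonneg_combs_emb_iff)
qed

text \<open>The integrality asked for by \<open>root_reflection\<close> holds because the sign
  dichotomy makes root coordinates integers and the Cartan matrix is integral.\<close>

lemma refl_single_in_R:
  assumes c: "c \<in> R" and i: "i \<in> I"
  shows "refl {i} c \<in> R"
proof -
  have "c k \<in> \<int>" if "k \<in> I" for k
    using root_coordinates_sign[OF c] that Nats_subset_Ints by (metis Ints_minus minus_minus subsetD)
  then have "(\<Sum>k\<in>I. c k * C k i) \<in> \<int>" by (intro Ints_sum Ints_mult C_Ints)
  then obtain m where m: "(\<Sum>k\<in>I. c k * C k i) = of_int m" by (elim Ints_cases)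
  have "(\<lambda>x. emb c x - of_int m * \<alpha> i x) \<in> \<Delta>"
    using c i m by (intro root_reflection \<alpha>_root \<alpha>_nonisotropic) (simp_all add: R_def dual_form_emb)
  then have "emb (refl {i} c) \<in> \<Delta>" by (simp add: emb_refl_single[OF i] m)
  then show ?thesis using c i by (simp add: R_def supported_refl)
qed

lemma refl_in_R:
  assumes "J \<subseteq> I" and orth: "\<And>i j. i \<in> J \<Longrightarrow> j \<in> J \<Longrightarrow> i \<noteq> j \<Longrightarrow> C i j = 0" and c: "c \<in> R"
  shows "refl J c \<in> R"
proof -
  have "finite J" using assms(1) finI finite_subset by blast
  then show ?thesis
    using assms(1,2)
  proof (induction J rule: finite_induct)
    case (insert i J)
    have "refl (insert i J) c = refl {i} (refl J c)" using insert by (intro refl_insert) auto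
    then show ?case using insert by (simp add: refl_single_in_R)
  qed (simp add: c)
qed

abbreviation \<beta> where "\<beta> \<equiv> signed_simple_root \<alpha> I1"

lemma supported_base: "i \<in> I \<Longrightarrow> supported (base i)"
  by (auto simp: supported_def base_def)

lemma emb_base: "i \<in> I \<Longrightarrow> emb (base i) = \<beta> i"
proof
  fix x assume i: "i \<in> I"
  have "emb (base i) x = (\<Sum>j\<in>I. if j = i then \<beta> i x else 0)"
    unfolding emb_def by (intro sum.cong) (auto simp: base_def signed_simple_root_def)
  then show "emb (base i) x = \<beta> i x" using i finI by simp
qed

lemma signed_base_root:
  assumes i: "i \<in> I"
  shows "base i \<in> R"
proof -
  \<comment> \<open>The negative of a simple root is its own reflection in itself, with Cartan
    number 2.\<close>
  have "(\<lambda>x. \<alpha> i x - of_int 2 * \<alpha> i x) \<in> \<Delta>"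
    using i \<alpha>_nonisotropic[OF i] by (intro root_reflection \<alpha>_root) simp_all
  moreover have "\<alpha> i x - of_int 2 * \<alpha> i x = - \<alpha> i x" for x by simp
  ultimately have "(\<lambda>x. - \<alpha> i x) \<in> \<Delta>" by simp
  then have "\<beta> i \<in> \<Delta>" using \<alpha>_root[OF i] by (simp add: signed_simple_root_def)
  then show ?thesis using i by (simp add: R_def emb_base supported_base)
qed

sublocale bipartite_root_coordinates I1 I2 C v g R
proof unfold_locales
  show "refl I1 c \<in> R" if "c \<in> R" for c using orth1 that by (intro refl_in_R) auto
  show "refl I2 c \<in> R" if "c \<in> R" for c using orth2 that by (intro refl_in_R) auto
qed (use signed_base_root root_coordinates_sign in \<open>auto simp: R_def supported_def\<close>)

section \<open>Order of the Coxeter element, positive parts of orbits, root numbers\<close>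

lemma supported_orbit: "i \<in> I \<Longrightarrow> supported ((cox_inv ^^ m) (base i))"
  using orbit_in_R by (simp add: R_def)

lemma cox_pow_orbit:
  assumes "m \<le> 2 * g" and i: "i \<in> I"
  shows "(cox ^^ m) (base i) = (cox_inv ^^ (2 * g - m)) (base i)"
proof -
  have "(cox_inv ^^ m) ((cox_inv ^^ (2 * g - m)) (base i)) = base i"
    using assms by (simp add: cox_inv_period_base flip: funpow_add[unfolded o_def, THEN fun_cong])
  then show ?thesis by (metis cox_pow_cox_inv_pow)
qed

text \<open>The plane angles along a single orbit show that the order is a multiple of 2g; the
  converse is the period 2g on every supported vector, hence on the whole dual space.\<close>

lemma ord_\<sigma>: "W.ord \<sigma> = 2 * g"
proof -
  have "\<sigma> [^]\<^bsub>BijGroup V\<^esub> n = \<one>\<^bsub>BijGroup V\<^esub> \<longleftrightarrow> 2 * g dvd n" for n :: nat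
  proof
    assume "\<sigma> [^]\<^bsub>BijGroup V\<^esub> n = \<one>\<^bsub>BijGroup V\<^esub>"
    then have one: "emb ((cox ^^ n) c) = emb c" for c
      using \<sigma>_pow_emb[of n c] by (simp add: BijGroup_def emb_in_V)
    obtain i where i: "i \<in> I" using nonempty by auto
    have sup: "supported ((cox ^^ n) (base i))"
      using i by (induction n) (simp_all add: supported_base cox_def supported_refl)
    then have "(cox ^^ n) (base i) = base i"
      using one[of "base i"] i by (simp add: emb_inj supported_base)
    then have "(cox_inv ^^ n) (base i) = (cox_inv ^^ 0) (base i)"
      using cox_inv_pow_cox_pow[of n "base i"] by (simp only: funpow_0)
    then show "2 * g dvd n" using orbit_eq_iff[OF i i, of n 0] by (simp add: mod_eq_0_iff_dvd)
  next
    assume "2 * g dvd n"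
    then obtain q where "n = 2 * g * q" by (elim dvdE)
    then have q: "n = q * (2 * g)" by (simp only: mult.commute)
    have "(\<sigma> [^]\<^bsub>BijGroup V\<^esub> n) f = f" if f: "f \<in> V" for f
    proof -
      obtain c where c: "supported c" "f = emb c" using V_emb[OF f] by metis
      have "(cox_inv ^^ (2 * g)) c = c"
        using c(1) by (intro cox_inv_period) (simp add: supported_def)
      then have period: "(cox ^^ (2 * g)) c = c"
        using cox_pow_cox_inv_pow[of "2 * g" c] by (simp only:)
      have "(cox ^^ (q * (2 * g))) c = c"
        by (induction q) (simp_all only: mult_Suc mult_0 funpow_add funpow_0 o_apply period)
      then show ?thesis by (simp only: c(2) q \<sigma>_pow_emb)
    qed
    moreover have "\<sigma> [^]\<^bsub>BijGroup V\<^esub> n \<in> extensional V"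
      using W.nat_pow_closed[of \<sigma> n] \<sigma>_Bij by (simp add: carrier_W Bij_imp_extensional)
    moreover have "\<one>\<^bsub>BijGroup V\<^esub> = (\<lambda>f\<in>V. f)" by (simp add: BijGroup_def)
    ultimately show "\<sigma> [^]\<^bsub>BijGroup V\<^esub> n = \<one>\<^bsub>BijGroup V\<^esub>"
      by (simp only:) (rule extensionalityI[of _ V], simp_all only: restrict_extensional restrict_apply')
  qed
  then show ?thesis using W.ord_unique[of \<sigma> "2 * g"] \<sigma>_Bij by (simp add: carrier_W)
qed

text \<open>Inverse steps are counted, so that m is the exponent of \<sigma> that leads back to
  \<beta> i.\<close>

definition orbit_root :: "nat \<Rightarrow> nat \<Rightarrow> 'g \<Rightarrow> complex" where
  "orbit_root i m = emb ((cox_inv ^^ m) (base i))"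

lemma orbit_root_eq_iff:
  "i \<in> I \<Longrightarrow> j \<in> I \<Longrightarrow> orbit_root i m = orbit_root j n \<longleftrightarrow> i = j \<and> m mod (2 * g) = n mod (2 * g)"
  by (simp add: orbit_root_def emb_inj supported_orbit orbit_eq_iff)

abbreviation \<Delta>p where "\<Delta>p \<equiv> positive_roots \<Delta> \<alpha> I"

definition steps :: "nat \<Rightarrow> nat set" where
  "steps i = (if i \<in> I1 then {0..<g} else {1..g})"

lemma orbit_root_positive_iff:
  assumes "i \<in> I" "m < 2 * g"
  shows "orbit_root i m \<in> \<Delta>p \<longleftrightarrow> m \<in> steps i"
proof -
  have "orbit_root i m \<in> \<Delta>p \<longleftrightarrow> (\<forall>j\<in>I. (cox_inv ^^ m) (base i) j \<in> \<nat>)"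
    using orbit_in_R[OF assms(1), of m]
    by (simp add: orbit_root_def positive_roots_def R_def nonneg_combs_emb_iff)
  then show ?thesis
    using assms disj orbit1_positive_iff[of i m] orbit2_positive_iff[of i m] by (auto simp: steps_def)
qed

lemma steps_less: "m \<in> steps i \<Longrightarrow> m < 2 * g"
  using g_pos by (auto simp: steps_def split: if_splits)

lemma orbit_pos_eq:
  assumes i: "i \<in> I"
  shows "orbit_pos V \<Delta>p \<sigma> (\<beta> i) = orbit_root i ` steps i"
proof -
  have red: "orbit_root i m = orbit_root i (m mod (2 * g))" for m
    using orbit_root_eq_iff[OF i i] by simp
  have gen: "generate (BijGroup V) {\<sigma>} = {\<sigma> [^]\<^bsub>BijGroup V\<^esub> k | k. k \<in> (UNIV :: nat set)}"
    using \<sigma>_Bij g_pos by (intro W.generate_pow_nat) (simp_all add: carrier_W ord_\<sigma>)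
  have "{w (\<beta> i) | w. w \<in> generate (BijGroup V) {\<sigma>}}
      = range (\<lambda>k :: nat. (\<sigma> [^]\<^bsub>BijGroup V\<^esub> k) (\<beta> i))"
    unfolding gen by blast
  also have "\<dots> = range (\<lambda>k. emb ((cox ^^ k) (base i)))"
    by (simp only: emb_base[OF i, symmetric] \<sigma>_pow_emb)
  also have "\<dots> = range (orbit_root i)"
  proof safe
    fix k
    \<comment> \<open>The exponent k (2g) - k is a natural number congruent to -k modulo the period,
      so a forward power is rewritten as an inverse one.\<close>
    have "(cox_inv ^^ k) ((cox_inv ^^ (k * (2 * g) - k)) (base i)) = (cox_inv ^^ (k * (2 * g))) (base i)"
      using g_pos by (simp flip: funpow_add[unfolded o_def, THEN fun_cong])
    also have "\<dots> = base i" using orbit_eq_iff[OF i i, of "k * (2 * g)" 0] by simp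
    finally have "(cox ^^ k) (base i) = (cox_inv ^^ (k * (2 * g) - k)) (base i)"
      by (metis cox_pow_cox_inv_pow)
    then show "emb ((cox ^^ k) (base i)) \<in> range (orbit_root i)" by (auto simp: orbit_root_def)
  next
    fix m
    \<comment> \<open>Reducing m first keeps the forward exponent between 1 and 2g, with no
      truncated subtraction.\<close>
    have "(cox ^^ (2 * g - m mod (2 * g))) (base i) = (cox_inv ^^ (m mod (2 * g))) (base i)"
      using g_pos i by (subst cox_pow_orbit) auto
    then have "emb ((cox ^^ (2 * g - m mod (2 * g))) (base i)) = orbit_root i m"
      by (simp only: orbit_root_def[of i "m mod (2 * g)", symmetric] red[of m, symmetric])
    from this[symmetric] show "orbit_root i m \<in> range (\<lambda>k. emb ((cox ^^ k) (base i)))"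
      by (rule image_eqI) (rule UNIV_I)
  qed
  finally have "orbit_pos V \<Delta>p \<sigma> (\<beta> i) = \<Delta>p \<inter> range (orbit_root i)"
    by (simp add: orbit_pos_def)
  also have "\<dots> = orbit_root i ` steps i"
  proof safe
    fix m assume "orbit_root i m \<in> \<Delta>p"
    then have "orbit_root i (m mod (2 * g)) \<in> \<Delta>p" by (simp only: red[of m, symmetric])
    then have "m mod (2 * g) \<in> steps i"
      using orbit_root_positive_iff[OF i, of "m mod (2 * g)"] g_pos by simp
    then show "orbit_root i m \<in> orbit_root i ` steps i" by (subst red) (rule imageI)
  next
    fix m assume "m \<in> steps i"
    then show "orbit_root i m \<in> \<Delta>p" using orbit_root_positive_iff[OF i] steps_less by blast
  qed (rule rangeI)
  finally show ?thesis .
qed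

lemma orbit_index_orbit_root:
  assumes i: "i \<in> I" and m: "m \<in> steps i"
  shows "orbit_index V \<Delta>p \<sigma> \<beta> I1 I2 (orbit_root i m) = i"
  unfolding orbit_index_def
proof (rule the_equality)
  show "i \<in> I1 \<union> I2 \<and> orbit_root i m \<in> orbit_pos V \<Delta>p \<sigma> (\<beta> i)"
    using i m by (auto simp: orbit_pos_eq)
  show "j = i" if "j \<in> I1 \<union> I2 \<and> orbit_root i m \<in> orbit_pos V \<Delta>p \<sigma> (\<beta> j)" for j
    using that i by (auto simp: orbit_pos_eq orbit_root_eq_iff)
qed

lemma \<sigma>_pow_orbit_root_eq_iff:
  assumes "i \<in> I"
  shows "(\<sigma> [^]\<^bsub>BijGroup V\<^esub> n) (orbit_root i m) = \<beta> i \<longleftrightarrow> n mod (2 * g) = m mod (2 * g)"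
proof -
  have sup: "supported ((cox ^^ n) ((cox_inv ^^ m) (base i)))"
    using assms by (induction n) (simp_all add: supported_orbit cox_def supported_refl)
  have "(\<sigma> [^]\<^bsub>BijGroup V\<^esub> n) (orbit_root i m) = \<beta> i
      \<longleftrightarrow> (cox ^^ n) ((cox_inv ^^ m) (base i)) = base i"
    using sup assms
    by (simp add: orbit_root_def \<sigma>_pow_emb emb_inj supported_base flip: emb_base)
  also have "\<dots> \<longleftrightarrow> (cox_inv ^^ m) (base i) = (cox_inv ^^ n) (base i)"
    by (metis cox_inv_pow_cox_pow cox_pow_cox_inv_pow)
  finally show ?thesis using orbit_eq_iff[OF assms assms] by auto
qed

text \<open>Powers of \<sigma> are only known modulo 2g, but the bound n \<le> 2g keeps the exponent
  at most g, strictly below the period. The congruence becomes an equality and the description by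
  \<open>THE\<close> is unique.\<close>

lemma root_number_orbit_root:
  assumes i: "i \<in> I" and m: "m \<in> steps i"
  shows "root_number V \<Delta>p \<sigma> \<beta> I1 I2 (orbit_root i m) = (if i \<in> I1 then 2 * m + 1 else 2 * m)"
proof -
  have h: "coxeter_number V \<sigma> = 2 * g" by (simp add: coxeter_number_def ord_\<sigma>)
  show ?thesis
  proof (cases "i \<in> I1")
    case True
    have "root_number V \<Delta>p \<sigma> \<beta> I1 I2 (orbit_root i m) = (THE n. 1 \<le> n \<and> n \<le> 2 * g \<and> odd n \<and>
        ((n - 1) div 2) mod (2 * g) = m mod (2 * g))"
      using True by (simp add: root_number_def Let_def orbit_part_def orbit_index_orbit_root[OF i m] h
          \<sigma>_pow_orbit_root_eq_iff[OF i])
    also have "\<dots> = 2 * m + 1"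
    proof (rule the_equality)
      have mg: "m < g" using m True by (simp add: steps_def)
      then show "1 \<le> 2 * m + 1 \<and> 2 * m + 1 \<le> 2 * g \<and> odd (2 * m + 1) \<and>
          ((2 * m + 1 - 1) div 2) mod (2 * g) = m mod (2 * g)" by simp
      fix n assume n: "1 \<le> n \<and> n \<le> 2 * g \<and> odd n \<and> ((n - 1) div 2) mod (2 * g) = m mod (2 * g)"
      then obtain k where k: "n = 2 * k + 1" by (auto elim: oddE)
      then have "k mod (2 * g) = m mod (2 * g)" using n by simp
      moreover have "k < 2 * g" "m < 2 * g" using n k mg by linarith+
      ultimately show "n = 2 * m + 1" using k by (simp only: mod_less)
    qed
    finally show ?thesis using True by simp
  next
    case False
    have "root_number V \<Delta>p \<sigma> \<beta> I1 I2 (orbit_root i m) = (THE n. 1 \<le> n \<and> n \<le> 2 * g \<and> even n \<and>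
        (n div 2) mod (2 * g) = m mod (2 * g))"
      using False by (simp add: root_number_def Let_def orbit_part_def orbit_index_orbit_root[OF i m] h
          \<sigma>_pow_orbit_root_eq_iff[OF i])
    also have "\<dots> = 2 * m"
    proof (rule the_equality)
      have mg: "1 \<le> m" "m \<le> g" using m False by (simp_all add: steps_def)
      then show "1 \<le> 2 * m \<and> 2 * m \<le> 2 * g \<and> even (2 * m) \<and>
          ((2 * m) div 2) mod (2 * g) = m mod (2 * g)" by simp
      fix n assume n: "1 \<le> n \<and> n \<le> 2 * g \<and> even n \<and> (n div 2) mod (2 * g) = m mod (2 * g)"
      then obtain k where k: "n = 2 * k" by (auto elim: evenE)
      then have "k mod (2 * g) = m mod (2 * g)" using n by simp
      moreover have "k < 2 * g" "m < 2 * g" using n k mg by linarith+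
      ultimately show "n = 2 * m" using k by (simp only: mod_less)
    qed
    finally show ?thesis using False by simp
  qed
qed

text \<open>\<open>f\<close> recovers the step count from n, so m \<mapsto>
  \<open>orbit_root i m\<close> is the inverse map; one argument serves both parts.\<close>

lemma root_number_bij_betw:
  assumes i: "i \<in> I"
    and f: "\<And>m. f (if i \<in> I1 then 2 * m + 1 else 2 * m) = m"
  shows "bij_betw (\<lambda>\<phi>. f (root_number V \<Delta>p \<sigma> \<beta> I1 I2 \<phi>)) (orbit_pos V \<Delta>p \<sigma> (\<beta> i)) (steps i)"
proof -
  have num: "f (root_number V \<Delta>p \<sigma> \<beta> I1 I2 (orbit_root i m)) = m" if "m \<in> steps i" for m
    unfolding root_number_orbit_root[OF i that] by (rule f)
  show ?thesis
    by (rule bij_betw_byWitness[where f' = "orbit_root i"]) (auto simp: orbit_pos_eq[OF i] num)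
qed

end

text \<open>The junk value of \<open>dual_vector\<close> is harmless here: the Dynkin type forces \<open>B (\<alpha> i) (\<alpha> i) \<noteq> 0\<close>, which
  already exhibits a nonzero value of the Killing form.\<close>

theorem theorem1p12:
  fixes scale :: "complex \<Rightarrow> 'g::ab_group_add \<Rightarrow> 'g"
    and Basis H :: "'g set"
    and br :: "'g \<Rightarrow> 'g \<Rightarrow> 'g"
    and V \<Delta> \<Delta>p :: "('g \<Rightarrow> complex) set"
    and B :: "('g \<Rightarrow> complex) \<Rightarrow> ('g \<Rightarrow> complex) \<Rightarrow> complex"
    and l h g :: nat
    and I I1 I2 :: "nat set"
    and \<alpha> \<beta> :: "nat \<Rightarrow> 'g \<Rightarrow> complex"
    and \<psi> :: "'g \<Rightarrow> complex"
    and \<sigma> :: "('g \<Rightarrow> complex) \<Rightarrow> ('g \<Rightarrow> complex)"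
    and n :: "('g \<Rightarrow> complex) \<Rightarrow> nat"
  assumes "complex_simple_lie_algebra scale Basis br"
    and "cartan_subalgebra scale br H"
    and "l = vector_space.dim scale H"
    and "I = {1..l}"
    and "V = dual_space scale H"
    and "B = dual_form scale Basis br H"
    and "\<Delta> = roots scale br H"
    and "simple_roots \<Delta> \<alpha> I"
    and "\<Delta>p = positive_roots \<Delta> \<alpha> I"
    and "has_dynkin_type B \<alpha> l Type_A \<and> odd l \<or>
         has_dynkin_type B \<alpha> l Type_D \<and> 4 \<le> l \<or>
         has_dynkin_type B \<alpha> l Type_E \<and> l \<in> {6, 7, 8}"
    and "highest_root \<Delta> \<alpha> I \<psi>"
    and "I1 \<union> I2 = I" and "I1 \<inter> I2 = {}"
    and "\<forall>i\<in>I1. \<forall>j\<in>I1. i \<noteq> j \<longrightarrow> B (\<alpha> i) (\<alpha> j) = 0"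
    and "\<forall>i\<in>I2. \<forall>j\<in>I2. i \<noteq> j \<longrightarrow> B (\<alpha> i) (\<alpha> j) = 0"
    and "\<forall>i\<in>I2. B (\<alpha> i) \<psi> = 0"
    and "\<sigma> = coxeter_element V B \<alpha> I1 I2"
    and "h = coxeter_number V \<sigma>"
    and "g = h div 2"
    and "\<beta> = signed_simple_root \<alpha> I1"
    and "n = root_number V \<Delta>p \<sigma> \<beta> I1 I2"
  shows "(\<forall>i\<in>I1. bij_betw (\<lambda>\<phi>. (n \<phi> - 1) div 2) (orbit_pos V \<Delta>p \<sigma> (\<beta> i)) {0..<g}) \<and>
         (\<forall>i\<in>I2. bij_betw (\<lambda>\<phi>. n \<phi> div 2) (orbit_pos V \<Delta>p \<sigma> (\<beta> i)) {1..g})"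
proof -
  interpret L: complex_simple_lie_algebra scale Basis br by fact
  obtain X where X: "has_dynkin_type B \<alpha> l X"
    and Xl: "X = Type_A \<and> odd l \<or> X = Type_D \<and> 4 \<le> l \<or> X = Type_E \<and> l \<in> {6, 7, 8}"
    using assms(10) by blast
  obtain p where p: "bij_betw p {1..l} {1..l}"
    and cartan: "\<And>i j. i \<in> {1..l} \<Longrightarrow> j \<in> {1..l} \<Longrightarrow>
      2 * B (\<alpha> i) (\<alpha> j) / B (\<alpha> j) (\<alpha> j) = cartan_entry X l (p i) (p j)"
    using X unfolding has_dynkin_type_def by blast
  obtain k v where k: "0 < k" and v: "perron_vector X l k v"
    using perron_vector_exists[OF Xl] by blast
  have I: "I1 \<union> I2 = {1..l}" using assms(4,12) by simp
  have "1 \<le> l" using Xl by (cases "l = 0") auto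
  have p_in: "p i \<in> {1..l}" if "i \<in> I1 \<union> I2" for i
    using that p unfolding I by (rule bij_betwE[rule_format, rotated])
  have p_neq: "p i \<noteq> p j" if "i \<in> I1 \<union> I2" "j \<in> I1 \<union> I2" "i \<noteq> j" for i j
    using that p unfolding I bij_betw_def inj_on_def by blast
  \<comment> \<open>The renumbering \<open>p\<close> is absorbed into the matrix and the
    eigenvector, so \<open>I1\<close>, \<open>I2\<close> and \<alpha> keep their own labels.\<close>
  interpret L: bipartite_root_system scale Basis br H I1 I2 "\<lambda>i j. cartan_entry X l (p i) (p j)"
    "\<lambda>i. v (p i)" k \<alpha>
  proof unfold_locales
    show "cartan_subalgebra scale br H" by fact
    show "\<exists>x y. killing_form scale Basis br x y \<noteq> 0"
    proof -
      have "B (\<alpha> 1) (\<alpha> 1) \<noteq> 0"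
        using cartan[of 1 1] \<open>1 \<le> l\<close> by (auto simp: cartan_entry_def)
      then show ?thesis unfolding assms(6) dual_form_def by blast
    qed
    have "finite (I1 \<union> I2)" unfolding I by simp
    then show "finite I1" "finite I2" by simp_all
    show "I1 \<inter> I2 = {}" by fact
    show "cartan_entry X l (p i) (p i) = 2" if "i \<in> I1 \<union> I2" for i
      by (simp add: cartan_entry_def)
    show "cartan_entry X l (p i) (p j) = 0" if "i \<in> I1" "j \<in> I1" "i \<noteq> j" for i j
    proof -
      have "i \<in> {1..l}" "j \<in> {1..l}" unfolding I[symmetric] using that by simp_all
      moreover have "B (\<alpha> i) (\<alpha> j) = 0" using assms(14) that by blast
      ultimately show ?thesis using cartan[of i j] by simp
    qed
    show "cartan_entry X l (p i) (p j) = 0" if "i \<in> I2" "j \<in> I2" "i \<noteq> j" for i j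
    proof -
      have "i \<in> {1..l}" "j \<in> {1..l}" unfolding I[symmetric] using that by simp_all
      moreover have "B (\<alpha> i) (\<alpha> j) = 0" using assms(15) that by blast
      ultimately show ?thesis using cartan[of i j] by simp
    qed
    show "0 < v (p i)" if "i \<in> I1 \<union> I2" for i
      using v p_in[OF that] unfolding perron_vector_def by blast
    show "0 < k" by fact
    show "(\<Sum>j\<in>I1 \<union> I2. cartan_entry X l (p i) (p j) * of_real (v (p j)))
        = of_real ((2 - 2 * cos (pi / (2 * real k))) * v (p i))" if "i \<in> I1 \<union> I2" for i
    proof -
      have "(\<Sum>j\<in>I1 \<union> I2. cartan_entry X l (p i) (p j) * of_real (v (p j)))
          = (\<Sum>j\<in>{1..l}. cartan_entry X l (p i) j * of_real (v j))"
        unfolding I by (rule sum.reindex_bij_betw[OF p])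
      then show ?thesis using v p_in[OF that] unfolding perron_vector_def by simp
    qed
    show "card (I1 \<union> I2) = L.dim H" unfolding I assms(3) by simp
    show "I1 \<union> I2 \<noteq> {}" using \<open>1 \<le> l\<close> by (simp add: I)
    show "simple_roots (roots scale br H) \<alpha> (I1 \<union> I2)"
      using assms(7,8,12) by simp
    show "2 * dual_form scale Basis br H (\<alpha> i) (\<alpha> j) / dual_form scale Basis br H (\<alpha> j) (\<alpha> j)
        = cartan_entry X l (p i) (p j)" if "i \<in> I1 \<union> I2" "j \<in> I1 \<union> I2" for i j
      using cartan that unfolding I assms(6) by blast
    show "cartan_entry X l (p i) (p j) \<in> \<int>" for i j
      by (simp add: cartan_entry_def)
  qed
  have h: "h = 2 * k"
    unfolding assms(5,6,17,18) coxeter_number_def by (rule L.ord_\<sigma>)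
  then have g: "g = k" by (simp add: assms(19))
  have \<Delta>p: "\<Delta>p = positive_roots (roots scale br H) \<alpha> (I1 \<union> I2)"
    using assms(7,9,12) by simp
  show ?thesis
    unfolding assms(5,6,17,20,21) \<Delta>p g
  proof (intro conjI ballI)
    fix i assume i: "i \<in> I1"
    show "bij_betw (\<lambda>\<phi>. (root_number L.V L.\<Delta>p L.\<sigma> L.\<beta> I1 I2 \<phi> - 1) div 2)
        (orbit_pos L.V L.\<Delta>p L.\<sigma> (L.\<beta> i)) {0..<k}"
      using L.root_number_bij_betw[of i "\<lambda>n. (n - 1) div 2"] i by (simp add: L.steps_def)
  next
    fix i assume i: "i \<in> I2"
    then have "i \<notin> I1" using assms(13) by auto
    then show "bij_betw (\<lambda>\<phi>. root_number L.V L.\<Delta>p L.\<sigma> L.\<beta> I1 I2 \<phi> div 2)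
        (orbit_pos L.V L.\<Delta>p L.\<sigma> (L.\<beta> i)) {1..k}"
      using L.root_number_bij_betw[of i "\<lambda>n. n div 2"] i by (simp add: L.steps_def)
  qed
qed

end
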